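(* There exist groups that are simultaneously finitely generated, simple, infinite and amenable. In fact, there are $2^{\aleph_0}$ pairwise non-isomorphic such groups.
   Context: A discrete group $G$ is amenable if it admits a left-invariant mean, i.e. a finitely additive probability measure defined on all subsets of $G$ and invariant under left translations. *)

theory Defs
  imports
    Complex_Main
    "HOL-Algebra.Generated_Groups"
    "HOL-Library.Equipollence"
begin

definition finitely_generated_group :: "('a, 'b) monoid_scheme \<Rightarrow> bool" where
  "finitely_generated_group G \<longleftrightarrow>
     group G \<and> (\<exists>S. finite S \<and> S \<subseteq> carrier G \<and> generate G S = carrier G)"

text \<open>
  The locale \<open>simple_group\<close> of HOL-Algebra expresses nontriviality as \<open>order G > 1\<close>, where
  \<open>order G\<close> is the cardinality as a natural number and hence 0 for infinite groups. That locale
  therefore contains only finite groups, so nontriviality is stated differently here.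
\<close>

definition is_simple_group :: "('a, 'b) monoid_scheme \<Rightarrow> bool" where
  "is_simple_group G \<longleftrightarrow>
     group G \<and> carrier G \<noteq> {\<one>\<^bsub>G\<^esub>} \<and> (\<forall>N. N \<lhd> G \<longrightarrow> N = carrier G \<or> N = {\<one>\<^bsub>G\<^esub>})"

text \<open>Only the values of a mean on subsets of the carrier are relevant.\<close>

definition left_invariant_mean :: "('a, 'b) monoid_scheme \<Rightarrow> ('a set \<Rightarrow> real) \<Rightarrow> bool" where
  "left_invariant_mean G \<mu> \<longleftrightarrow>
     (\<forall>A. A \<subseteq> carrier G \<longrightarrow> 0 \<le> \<mu> A) \<and>
     \<mu> (carrier G) = 1 \<and>
     (\<forall>A B. A \<subseteq> carrier G \<longrightarrow> B \<subseteq> carrier G \<longrightarrow> A \<inter> B = {} \<longrightarrow> \<mu> (A \<union> B) = \<mu> A + \<mu> B) \<and>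
     (\<forall>g \<in> carrier G. \<forall>A. A \<subseteq> carrier G \<longrightarrow> \<mu> (g <#\<^bsub>G\<^esub> A) = \<mu> A)"

definition amenable_group :: "('a, 'b) monoid_scheme \<Rightarrow> bool" where
  "amenable_group G \<longleftrightarrow> group G \<and> (\<exists>\<mu>. left_invariant_mean G \<mu>)"

text \<open>
  Every finitely generated group is countable, so the infinite ones are all represented, up to
  isomorphism, by groups whose elements are natural numbers.
\<close>

definition fg_simple_infinite_amenable :: "nat monoid \<Rightarrow> bool" where
  "fg_simple_infinite_amenable G \<longleftrightarrow>
     finitely_generated_group G \<and> is_simple_group G \<and> infinite (carrier G) \<and> amenable_group G"

end

theory Submission
  imports Defs "HOL-Analysis.Function_Topology" "HOL-Analysis.Convex"
begin

text \<open>
  To every set \<open>X\<close> of natural numbers belongs a group \<open>Gamma X\<close> of permutations of the integers,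
  generated by nine elements of order three. It is a group of piecewise translations in the sense
  of topological full groups of Toeplitz subshifts: the elements move integers by a bounded amount,
  and the displacement at \<open>n\<close> depends on the position of \<open>n\<close> relative to a 2-adic Toeplitz
  sequence. The sequence records, for \<open>n\<close> with \<open>3 * n + 1\<close> exactly divisible by \<open>2 ^ k\<close>, one bit
  that depends on \<open>k\<close> and \<open>X\<close>; the number \<open>-1/3\<close> is a 2-adic integer but not an integer, so
  every \<open>n\<close> has such a \<open>k\<close>.

  Finite generation holds by construction. What has to be shown is that nine elements suffice to
  produce the 3-cycles on all the residue classes modulo powers of two. The commutator of two
  3-cycles that meet in one position is a 3-cycle on the intersection of their bases, so the sets
  that carry a 3-cycle of the group are closed under Boolean operations and translations, and the
  Toeplitz sequence is chosen such that these operations recover all the residue classes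
  (\<open>definable_residue_class_power\<close>). Simplicity is then a double commutator argument: an element
  of a normal subgroup that moves \<open>n\<close> translates a whole residue class of \<open>n\<close>, which puts a 3-cycle
  into the normal subgroup (\<open>N_tricycle_seed\<close>), and conjugates and commutators of it give all the
  generators (\<open>normal_subset.N_trivial_or_full\<close>).

  Amenability follows the strategy of Juschenko and Monod. The group acts on the subsets of the
  integers that contain almost all positive and almost no negative integers. On this space there
  are finitely supported probability measures that are almost invariant under all permutations of
  bounded displacement: choose each integer independently, with a probability that grows from
  \<open>0\<close> to \<open>1\<close> as the squared sine of a slowly increasing angle. The corresponding unit vectors have
  inner products that are products of cosines of small angles
  (\<open>almost_invariant_cut_measure\<close>). The stabilizer of a point is locally finite, because an element
  that preserves one such subset preserves its translates by all multiples of some period, and this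
  confines orbits to bounded blocks (\<open>stabilizer_locally_finite\<close>). An almost invariant measure can
  be lifted through locally finite stabilizers to the group (\<open>amenable_if_almost_invariant\<close>), and
  compactness turns approximately invariant means into an invariant one.

  For the number of isomorphism classes it is enough to distinguish the groups together with their
  generators: a fixed word in the generators is trivial in \<open>Gamma X\<close> or not, according to a given
  bit of \<open>X\<close> (\<open>relations_determine\<close>), while a given finitely generated group has only countably
  many tuples of nine generators (\<open>countable_iso_class\<close>). A partition of a set of size continuum
  into countable classes has continuum many classes.
\<close>

section \<open>Simultaneous 3-cycles on the integers\<close>

text \<open>
  The integers \<open>u + i\<close>, \<open>u + j\<close>, \<open>u + k\<close> are permuted cyclically for all \<open>u\<close> in \<open>U\<close> at once. This
  is a permutation only if these triples are disjoint, which \<open>spread\<close> expresses.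
\<close>

definition cyc3 :: "int set \<Rightarrow> int \<Rightarrow> int \<Rightarrow> int \<Rightarrow> int \<Rightarrow> int" where
  "cyc3 U i j k n =
     (if n - i \<in> U then n - i + j else if n - j \<in> U then n - j + k
      else if n - k \<in> U then n - k + i else n)"

definition spread :: "int set \<Rightarrow> int set \<Rightarrow> bool" where
  "spread U P \<longleftrightarrow> (\<forall>u \<in> U. \<forall>p \<in> P. \<forall>q \<in> P. p \<noteq> q \<longrightarrow> u + p - q \<notin> U)"

definition shift :: "int \<Rightarrow> int set \<Rightarrow> int set" where
  "shift t U = {n. n - t \<in> U}"

definition residue_class :: "int \<Rightarrow> int \<Rightarrow> int set" where
  "residue_class M a = {n. M dvd n - a}"

lemma mem_shift [simp]: "n \<in> shift t U \<longleftrightarrow> n - t \<in> U"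
  by (simp add: shift_def)

lemma shift_residue_class: "shift t (residue_class M a) = residue_class M (a + t)"
  by (auto simp: residue_class_def algebra_simps)

lemma cyc3_shift: "cyc3 (shift t U) i j k = cyc3 U (i + t) (j + t) (k + t)"
  by (rule ext) (simp add: cyc3_def diff_diff_eq add.commute add.left_commute algebra_simps)

lemma spread_mono: "spread W P \<Longrightarrow> U \<subseteq> W \<Longrightarrow> Q \<subseteq> P \<Longrightarrow> spread U Q"
  unfolding spread_def by blast

lemma spread_residue_class:
  assumes "\<And>p q. p \<in> P \<Longrightarrow> q \<in> P \<Longrightarrow> p \<noteq> q \<Longrightarrow> \<not> M dvd p - q"
  shows "spread (residue_class M a) P"
proof -
  { fix u p q assume "M dvd u - a" "M dvd u + p - q - a"
    then have "M dvd (u + p - q - a) - (u - a)" by (rule dvd_diff[rotated])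
    then have "M dvd p - q" by (simp add: algebra_simps) }
  with assms show ?thesis unfolding spread_def residue_class_def by blast
qed

text \<open>
  Positions are written as a base point \<open>u\<close> of the larger set \<open>W\<close> plus an offset \<open>p\<close>. If the
  translates of \<open>W\<close> by the offsets are disjoint, then 3-cycles based on several subsets of \<open>W\<close> can be
  composed by computing with the offsets alone.
\<close>

lemma cyc3_at:
  assumes "spread W P" "U \<subseteq> W" "u \<in> W" "i \<in> P" "j \<in> P" "k \<in> P" "p \<in> P"
  shows "cyc3 U i j k (u + p) =
    u + (if u \<in> U then if p = i then j else if p = j then k else if p = k then i else p else p)"
proof -
  have "u + p - q \<in> U \<longleftrightarrow> p = q \<and> u \<in> U" if "q \<in> P" for q
    using assms that unfolding spread_def by (cases "p = q") auto
  then show ?thesis using assms by (simp add: cyc3_def)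
qed

lemma cyc3_off:
  assumes "n - i \<notin> U" "n - j \<notin> U" "n - k \<notin> U" shows "cyc3 U i j k n = n"
  using assms by (simp add: cyc3_def)

lemma spread_ext:
  fixes W P :: "int set"
  assumes "\<And>u p. u \<in> W \<Longrightarrow> p \<in> P \<Longrightarrow> f (u + p) = g (u + p)"
    and "\<And>n. (\<forall>p \<in> P. n - p \<notin> W) \<Longrightarrow> f n = g n"
  shows "f = g"
proof
  fix n
  show "f n = g n"
  proof (cases "\<exists>p \<in> P. n - p \<in> W")
    case True
    then obtain p where "p \<in> P" "n - p \<in> W" by blast
    then have "f (n - p + p) = g (n - p + p)" using assms(1) by blast
    then show ?thesis by simp
  qed (use assms(2) in blast)
qed

text \<open>
  Conjugating a 3-cycle relabels its positions, also for a simultaneous 3-cycle. Injectivity ensures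
  that the relabelled cycle moves no further points.
\<close>

lemma cyc3_conj:
  assumes "inj \<sigma>"
    and "\<And>u. u \<in> U \<Longrightarrow> \<sigma> (u + i) = u + i' \<and> \<sigma> (u + j) = u + j' \<and> \<sigma> (u + k) = u + k'"
  shows "\<sigma> \<circ> cyc3 U i j k = cyc3 U i' j' k' \<circ> \<sigma>"
proof
  fix m
  have iff: "\<sigma> m - p' \<in> U \<longleftrightarrow> m - p \<in> U" if "\<And>u. u \<in> U \<Longrightarrow> \<sigma> (u + p) = u + p'" for p p'
  proof
    assume "\<sigma> m - p' \<in> U"
    then have "\<sigma> (\<sigma> m - p' + p) = \<sigma> m" using that by simp
    then have "\<sigma> m - p' + p = m" using \<open>inj \<sigma>\<close> by (simp only: inj_eq)
    then have "m - p = \<sigma> m - p'" by linarith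
    then show "m - p \<in> U" using \<open>\<sigma> m - p' \<in> U\<close> by (simp only:)
  next
    assume "m - p \<in> U"
    then have "\<sigma> m - p' = m - p" using that[of "m - p"] by simp
    then show "\<sigma> m - p' \<in> U" using \<open>m - p \<in> U\<close> by simp
  qed
  have I: "\<sigma> m - i' \<in> U \<longleftrightarrow> m - i \<in> U" "\<sigma> m - j' \<in> U \<longleftrightarrow> m - j \<in> U" "\<sigma> m - k' \<in> U \<longleftrightarrow> m - k \<in> U"
    using iff assms(2) by blast+
  show "(\<sigma> \<circ> cyc3 U i j k) m = (cyc3 U i' j' k' \<circ> \<sigma>) m"
    using I assms(2)[of "m - i"] assms(2)[of "m - j"] assms(2)[of "m - k"]
    by (auto simp: cyc3_def)
qed

lemma cyc3_cubed:
  assumes "spread U {i, j, k}" "distinct [i, j, k]"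
  shows "cyc3 U i j k \<circ> (cyc3 U i j k \<circ> cyc3 U i j k) = id"
proof (rule spread_ext[of U "{i,j,k}"])
  fix u p assume "u \<in> U" "p \<in> {i,j,k}"
  then show "(cyc3 U i j k \<circ> (cyc3 U i j k \<circ> cyc3 U i j k)) (u + p) = id (u + p)"
    using assms by (auto simp: cyc3_at[OF assms(1)])
qed (simp add: cyc3_off)

lemma cyc3_inverse:
  assumes "spread U {i, j, k}" "distinct [i, j, k]"
  shows "cyc3 U i j k \<circ> cyc3 U i k j = id"
proof (rule spread_ext[of U "{i,j,k}"])
  fix u p assume "u \<in> U" "p \<in> {i,j,k}"
  then show "(cyc3 U i j k \<circ> cyc3 U i k j) (u + p) = id (u + p)"
    using assms by (auto simp: cyc3_at[OF assms(1)])
qed (simp add: cyc3_off)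

lemma cyc3_squared:
  assumes "spread U {i, j, k}" "distinct [i, j, k]"
  shows "cyc3 U i j k \<circ> cyc3 U i j k = cyc3 U i k j"
proof (rule spread_ext[of U "{i,j,k}"])
  fix u p assume "u \<in> U" "p \<in> {i,j,k}"
  then show "(cyc3 U i j k \<circ> cyc3 U i j k) (u + p) = cyc3 U i k j (u + p)"
    using assms by (auto simp: cyc3_at[OF assms(1)])
qed (simp add: cyc3_off)

lemma bij_cyc3:
  assumes "spread U {i, j, k}" "distinct [i, j, k]" shows "bij (cyc3 U i j k)"
proof (rule o_bij)
  show "cyc3 U i k j \<circ> cyc3 U i j k = id"
    using assms cyc3_inverse[of U i k j] by (simp add: insert_commute)
  show "cyc3 U i j k \<circ> cyc3 U i k j = id" using assms by (rule cyc3_inverse)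
qed

lemma cyc3_rotate:
  assumes "spread U {i, j, k}" "distinct [i, j, k]"
  shows "cyc3 U j k i = cyc3 U i j k"
proof (rule spread_ext[of U "{i,j,k}"])
  fix u p assume "u \<in> U" "p \<in> {i,j,k}"
  then show "cyc3 U j k i (u + p) = cyc3 U i j k (u + p)"
    using assms by (auto simp: cyc3_at[OF assms(1)])
qed (simp add: cyc3_off)

lemma cyc3_union:
  assumes "spread (U \<union> V) {i, j, k}" "distinct [i, j, k]" "U \<inter> V = {}"
  shows "cyc3 U i j k \<circ> cyc3 V i j k = cyc3 (U \<union> V) i j k"
proof (rule spread_ext[of "U \<union> V" "{i,j,k}"])
  fix u p assume "u \<in> U \<union> V" "p \<in> {i,j,k}"
  then show "(cyc3 U i j k \<circ> cyc3 V i j k) (u + p) = cyc3 (U \<union> V) i j k (u + p)"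
    using assms(2,3) by (auto simp: cyc3_at[OF assms(1)])
qed (simp add: cyc3_off)

text \<open>
  Two simultaneous 3-cycles with one common position commute over base points that belong to one
  of the two sets only; over the others their commutator is again a 3-cycle. Thus commutators
  turn intersections of sets into products in the group.
\<close>

lemma cyc3_commutator:
  assumes "spread (U \<union> V) {i, j, k, l, m}" "distinct [i, j, k, l, m]"
  shows "cyc3 U i j k \<circ> cyc3 V k l m = cyc3 (U \<inter> V) i l k \<circ> (cyc3 V k l m \<circ> cyc3 U i j k)"
proof (rule spread_ext[of "U \<union> V" "{i,j,k,l,m}"])
  fix u p assume u: "u \<in> U \<union> V" and p: "p \<in> {i,j,k,l,m}"
  define P where "P = {i,j,k,l,m}"
  have mem: "i \<in> P" "j \<in> P" "k \<in> P" "l \<in> P" "m \<in> P" by (auto simp: P_def)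
  have ne: "i \<noteq> j" "i \<noteq> k" "i \<noteq> l" "i \<noteq> m" "j \<noteq> k" "j \<noteq> l" "j \<noteq> m" "k \<noteq> l" "k \<noteq> m" "l \<noteq> m"
    using assms(2) by auto
  note ne' = ne ne[symmetric]
  have sub: "U \<subseteq> U \<union> V" "V \<subseteq> U \<union> V" "U \<inter> V \<subseteq> U \<union> V" by auto
  note at = cyc3_at[OF assms(1)[folded P_def]]
  note K = at[OF sub(1) u mem(1,2,3)] and T = at[OF sub(2) u mem(3,4,5)] and R = at[OF sub(3) u mem(1,4,3)]
  have K': "cyc3 U i j k (u + i) = (if u \<in> U then u + j else u + i)"
    "cyc3 U i j k (u + j) = (if u \<in> U then u + k else u + j)"
    "cyc3 U i j k (u + k) = (if u \<in> U then u + i else u + k)"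
    "cyc3 U i j k (u + l) = u + l" "cyc3 U i j k (u + m) = u + m"
    by (simp_all only: K[OF mem(1)] K[OF mem(2)] K[OF mem(3)] K[OF mem(4)] K[OF mem(5)] ne' if_True if_False simp_thms if_distrib[of "(+) u"] if_cancel)
  have T': "cyc3 V k l m (u + i) = u + i" "cyc3 V k l m (u + j) = u + j"
    "cyc3 V k l m (u + k) = (if u \<in> V then u + l else u + k)"
    "cyc3 V k l m (u + l) = (if u \<in> V then u + m else u + l)"
    "cyc3 V k l m (u + m) = (if u \<in> V then u + k else u + m)"
    by (simp_all only: T[OF mem(1)] T[OF mem(2)] T[OF mem(3)] T[OF mem(4)] T[OF mem(5)] ne' if_True if_False simp_thms if_distrib[of "(+) u"] if_cancel)
  have R': "cyc3 (U \<inter> V) i l k (u + i) = (if u \<in> U \<inter> V then u + l else u + i)"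
    "cyc3 (U \<inter> V) i l k (u + j) = u + j"
    "cyc3 (U \<inter> V) i l k (u + k) = (if u \<in> U \<inter> V then u + i else u + k)"
    "cyc3 (U \<inter> V) i l k (u + l) = (if u \<in> U \<inter> V then u + k else u + l)"
    "cyc3 (U \<inter> V) i l k (u + m) = u + m"
    by (simp_all only: R[OF mem(1)] R[OF mem(2)] R[OF mem(3)] R[OF mem(4)] R[OF mem(5)] ne' if_True if_False simp_thms if_distrib[of "(+) u"] if_cancel)
  consider "p = i" | "p = j" | "p = k" | "p = l" | "p = m" using p by blast
  then show "(cyc3 U i j k \<circ> cyc3 V k l m) (u + p) =
      (cyc3 (U \<inter> V) i l k \<circ> (cyc3 V k l m \<circ> cyc3 U i j k)) (u + p)"
    by cases (cases "u \<in> U"; cases "u \<in> V"; simp add: K' T' R')+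
qed (simp add: cyc3_off)

section \<open>The generators and the sets that their words define\<close>

definition tricycle :: "int set \<Rightarrow> int \<Rightarrow> int" where
  "tricycle U = cyc3 U 0 1 2"

lemma tricycle_shift: "tricycle (shift t U) = cyc3 U t (1 + t) (2 + t)"
  unfolding tricycle_def cyc3_shift by simp

lemma spread_residue_class_interval:
  assumes "P \<subseteq> {x..<x + M}"
  shows "spread (residue_class M a) P"
proof (rule spread_residue_class)
  fix p q assume "p \<in> P" "q \<in> P" "p \<noteq> q"
  with assms have "x \<le> p" "p < x + M" "x \<le> q" "q < x + M" by auto
  then have "\<bar>p - q\<bar> < M" "p - q \<noteq> 0" using \<open>p \<noteq> q\<close> by linarith+
  then show "\<not> M dvd p - q" using dvd_imp_le_int[of "p - q" M] by auto
qed

lemma spread_tricycle: "U \<subseteq> residue_class M a \<Longrightarrow> M \<ge> 3 \<Longrightarrow> spread U {0, 1, 2}"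
  by (rule spread_mono[OF spread_residue_class_interval[of "{0,1,2}" 0 M a]]) auto

lemma bij_tricycle: "U \<subseteq> residue_class M a \<Longrightarrow> M \<ge> 3 \<Longrightarrow> bij (tricycle U)"
  unfolding tricycle_def by (rule bij_cyc3) (auto intro: spread_tricycle)

lemma tricycle_cubed: "U \<subseteq> residue_class M a \<Longrightarrow> M \<ge> 3 \<Longrightarrow> tricycle U \<circ> (tricycle U \<circ> tricycle U) = id"
  unfolding tricycle_def by (rule cyc3_cubed) (auto intro: spread_tricycle)

lemma tricycle_union:
  assumes "U \<subseteq> residue_class M a" "V \<subseteq> residue_class M a" "M \<ge> 3" "U \<inter> V = {}"
  shows "tricycle U \<circ> tricycle V = tricycle (U \<union> V)"
  unfolding tricycle_def by (rule cyc3_union) (use assms in \<open>auto intro: spread_tricycle[of _ M a]\<close>)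

lemma tricycle_residue_class_shift: "tricycle (residue_class M (a + t)) = cyc3 (residue_class M a) t (1 + t) (2 + t)"
  by (simp add: tricycle_shift[symmetric] shift_residue_class)

text \<open>
  The conjugating element acts as a 5-cycle on each block of positions \<open>0, ..., 4\<close>, hence advances
  the positions \<open>0, 1, 2\<close> by one.
\<close>

lemma tricycle_translate:
  assumes "U \<subseteq> residue_class M a" "M \<ge> 8"
  shows "(tricycle (residue_class M a) \<circ> tricycle (residue_class M (a + 2))) \<circ> tricycle U =
         tricycle (shift 1 U) \<circ> (tricycle (residue_class M a) \<circ> tricycle (residue_class M (a + 2)))"
proof -
  let ?P = "{0,1,2,3,4::int}"
  have sp: "spread (residue_class M a) ?P" by (rule spread_residue_class_interval[of _ 0]) (use assms in auto)
  have bij: "bij (tricycle (residue_class M b))" for b by (rule bij_tricycle[of _ M b]) (use assms in auto)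
  have at: "tricycle (residue_class M a) (u + p) = u + (if p = 0 then 1 else if p = 1 then 2 else if p = 2 then 0 else p)"
    "tricycle (residue_class M (a + 2)) (u + p) = u + (if p = 2 then 3 else if p = 3 then 4 else if p = 4 then 2 else p)"
    if "u \<in> U" "p \<in> ?P" for u p
    using that cyc3_at[OF sp subset_refl, of u 0 1 2 p] cyc3_at[OF sp subset_refl, of u 2 3 4 p] assms
    unfolding tricycle_def[of "residue_class M a"] tricycle_residue_class_shift by auto
  have at': "tricycle (residue_class M (a + 2)) u = u" "tricycle (residue_class M a) u = u + 1" if "u \<in> U" for u
    using at[of u 0] that by auto
  show ?thesis unfolding tricycle_shift tricycle_def[of U]
    by (rule cyc3_conj) (auto simp: at at' bij bij_is_inj intro!: inj_compose)
qed

lemma tricycle_commutator: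
  assumes "U \<subseteq> residue_class M a" "V \<subseteq> residue_class M a" "M \<ge> 8"
  shows "tricycle U \<circ> tricycle (shift 2 V) = cyc3 (U \<inter> V) 0 3 2 \<circ> (tricycle (shift 2 V) \<circ> tricycle U)"
proof -
  have "spread (U \<union> V) {0,1,2,3,4}"
    by (rule spread_mono[OF spread_residue_class_interval[of "{0,1,2,3,4}" 0 M a]]) (use assms in auto)
  from cyc3_commutator[OF this] show ?thesis unfolding tricycle_shift tricycle_def[of U] by simp
qed

text \<open>
  The commutator in \<open>tricycle_commutator\<close> moves the positions \<open>0, 2, 3\<close>. A further conjugation
  makes them consecutive again.
\<close>

lemma tricycle_restore:
  assumes "W \<subseteq> residue_class M a" "M \<ge> 8"
  shows "tricycle (residue_class M (a - 1)) \<circ> cyc3 W 0 2 3 = tricycle (shift 1 W) \<circ> tricycle (residue_class M (a - 1))"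
proof -
  let ?P = "{-1,0,1,2,3::int}"
  have sp: "spread (residue_class M a) ?P" by (rule spread_residue_class_interval[of _ "-1"]) (use assms in auto)
  have bij: "bij (tricycle (residue_class M (a - 1)))" by (rule bij_tricycle[of _ M "a - 1"]) (use assms in auto)
  have "tricycle (residue_class M (a - 1)) = cyc3 (residue_class M a) (-1) 0 1" using tricycle_residue_class_shift[of M a "-1"] by simp
  then have at: "tricycle (residue_class M (a - 1)) (u + p) =
      u + (if p = -1 then 0 else if p = 0 then 1 else if p = 1 then -1 else p)"
    if "u \<in> W" "p \<in> ?P" for u p
    using that cyc3_at[OF sp subset_refl, of u "-1" 0 1 p] assms by auto
  show ?thesis unfolding tricycle_shift
    by (rule cyc3_conj) (use at[of _ 0] in \<open>auto simp: at bij bij_is_inj\<close>)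
qed

lemma cyc3_032_squared:
  assumes "W \<subseteq> residue_class M a" "M \<ge> 8"
  shows "cyc3 W 0 3 2 \<circ> cyc3 W 0 3 2 = cyc3 W 0 2 3"
proof (rule cyc3_squared)
  show "spread W {0, 3, 2}"
    by (rule spread_mono[OF spread_residue_class_interval[of "{0,3,2}" 0 M a]]) (use assms in auto)
qed simp

text \<open>
  A decreasing sequence of residue classes modulo \<open>2 ^ k\<close>, the 2-adic neighbourhoods of \<open>-1/3\<close>. No
  integer lies in all of them.
\<close>

definition nest :: "nat \<Rightarrow> int set" where
  "nest k = {n. 2 ^ k dvd 3 * n + 1}"

text \<open>
  The residues modulo 3 keep both values of the bit present among any three consecutive \<open>k\<close>; the
  remaining third of the positions stores \<open>X\<close>. The shift of the quotient by one reflects that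
  only the positions \<open>k \<ge> 3\<close> are visible in \<open>marked\<close>.
\<close>

definition pattern :: "nat set \<Rightarrow> nat set" where
  "pattern X = {k. k mod 3 = 1 \<or> k mod 3 = 2 \<and> k div 3 - 1 \<in> X}"

text \<open>
  The Toeplitz sequence, as the set of integers at which its bit is one. Starting with \<open>k = 3\<close> keeps
  the set inside one residue class modulo 8.
\<close>

definition marked :: "nat set \<Rightarrow> int set" where
  "marked X = {n. \<exists>k \<ge> 3. n \<in> nest k - nest (Suc k) \<and> k \<in> pattern X}"

definition generator :: "nat set \<Rightarrow> nat \<Rightarrow> int \<Rightarrow> int" where
  "generator X i = (if i < 8 then tricycle (residue_class 8 (int i)) else tricycle (marked X))"

text \<open>
  Since the generators have order three, words without inverses yield the whole group.
\<close>

fun eval_word :: "nat set \<Rightarrow> nat list \<Rightarrow> int \<Rightarrow> int" where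
  "eval_word X [] = id"
| "eval_word X (i # w) = generator X i \<circ> eval_word X w"

lemma nest_mono: "k \<le> l \<Longrightarrow> nest l \<subseteq> nest k"
  unfolding nest_def using le_imp_power_dvd dvd_trans by blast

lemma nest_3: "nest 3 = residue_class 8 5"
  unfolding nest_def residue_class_def by (auto; presburger)

lemma nest_ge_3: "k \<ge> 3 \<Longrightarrow> nest k \<subseteq> residue_class 8 5"
  using nest_mono nest_3 by blast

lemma marked_subset: "marked X \<subseteq> residue_class 8 5"
  unfolding marked_def using nest_ge_3 by blast

lemma eval_word_append: "eval_word X (v @ w) = eval_word X v \<circ> eval_word X w"
  by (induction v) (auto simp: o_assoc)

lemma generator_class: "\<exists>U a. U \<subseteq> residue_class 8 a \<and> generator X i = tricycle U"
proof (cases "i < 8")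
  case True
  then have "residue_class 8 (int i) \<subseteq> residue_class 8 (int i) \<and> generator X i = tricycle (residue_class 8 (int i))" by (simp add: generator_def)
  then show ?thesis by blast
next
  case False
  then have "marked X \<subseteq> residue_class 8 5 \<and> generator X i = tricycle (marked X)" using marked_subset by (simp add: generator_def)
  then show ?thesis by blast
qed

lemma generator_cubed: "generator X i \<circ> (generator X i \<circ> generator X i) = id"
proof -
  obtain U a where "U \<subseteq> residue_class 8 a" "generator X i = tricycle U" using generator_class by blast
  then show ?thesis using tricycle_cubed[of U 8 a] by simp
qed

lemma bij_generator: "bij (generator X i)"
proof -
  obtain U a where "U \<subseteq> residue_class 8 a" "generator X i = tricycle U" using generator_class by blast
  then show ?thesis using bij_tricycle[of U 8 a] by simp
qed

lemma bij_eval_word: "bij (eval_word X w)"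
proof (induction w)
  case Nil
  then show ?case by (simp only: eval_word.simps bij_id)
next
  case (Cons i w)
  then show ?case by (simp only: eval_word.simps) (rule bij_comp[OF _ bij_generator])
qed

text \<open>
  One word is evaluated in all the groups simultaneously. This uniformity in \<open>X\<close> is what later
  compares groups for different \<open>X\<close>.
\<close>

definition word_maps :: "(nat set \<Rightarrow> int \<Rightarrow> int) set" where
  "word_maps = {f. \<exists>w. \<forall>X. f X = eval_word X w}"

lemma word_maps_comp: "f \<in> word_maps \<Longrightarrow> g \<in> word_maps \<Longrightarrow> (\<lambda>X. f X \<circ> g X) \<in> word_maps"
proof -
  assume "f \<in> word_maps" "g \<in> word_maps"
  then obtain v w where "\<forall>X. f X = eval_word X v" "\<forall>X. g X = eval_word X w" unfolding word_maps_def by blast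
  then have "\<forall>X. f X \<circ> g X = eval_word X (v @ w)" by (simp add: eval_word_append)
  then show ?thesis unfolding word_maps_def by blast
qed

lemma word_maps_generator: "(\<lambda>X. generator X i) \<in> word_maps"
  unfolding word_maps_def by (auto intro!: exI[of _ "[i]"])

lemma bij_word_maps: "f \<in> word_maps \<Longrightarrow> bij (f X)"
  unfolding word_maps_def using bij_eval_word by auto

lemma eval_word_inverse: "\<exists>v. \<forall>X. eval_word X v \<circ> eval_word X w = id"
proof (induction w)
  case (Cons i w)
  then obtain v where v: "\<forall>X. eval_word X v \<circ> eval_word X w = id" by blast
  have "eval_word X (v @ [i, i]) \<circ> eval_word X (i # w) = id" for X
  proof -
    have "eval_word X (v @ [i, i]) \<circ> eval_word X (i # w) =
        eval_word X v \<circ> (generator X i \<circ> (generator X i \<circ> generator X i)) \<circ> eval_word X w"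
      by (simp add: eval_word_append o_assoc)
    with v show ?thesis by (simp add: generator_cubed)
  qed
  then show ?case by blast
qed (auto intro: exI[of _ "[]"])

lemma word_maps_inv: "f \<in> word_maps \<Longrightarrow> (\<lambda>X. inv_into UNIV (f X)) \<in> word_maps"
proof -
  assume "f \<in> word_maps"
  then obtain w where w: "\<forall>X. f X = eval_word X w" unfolding word_maps_def by blast
  obtain v where v: "\<forall>X. eval_word X v \<circ> eval_word X w = id" using eval_word_inverse by blast
  have "inv_into UNIV (f X) = eval_word X v" for X
  proof (rule inv_unique_comp)
    show "eval_word X v \<circ> f X = id" using v w by simp
    then show "f X \<circ> eval_word X v = id"
      using bij_eval_word[of X w] w by (metis bij_is_surj comp_id o_assoc surj_iff id_comp)
  qed
  then show ?thesis unfolding word_maps_def by auto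
qed

lemma conjugate_eq: "bij \<sigma> \<Longrightarrow> \<sigma> \<circ> f = h \<circ> \<sigma> \<Longrightarrow> h = \<sigma> \<circ> (f \<circ> inv_into UNIV \<sigma>)"
  by (metis bij_is_surj comp_assoc comp_id surj_iff)

lemma conjugate_eq': "bij \<sigma> \<Longrightarrow> \<sigma> \<circ> h = f \<circ> \<sigma> \<Longrightarrow> h = inv_into UNIV \<sigma> \<circ> (f \<circ> \<sigma>)"
  by (metis bij_is_inj comp_assoc id_comp inv_o_cancel)

lemma commutator_eq:
  "bij f \<Longrightarrow> bij g \<Longrightarrow> f \<circ> g = h \<circ> (g \<circ> f) \<Longrightarrow> h = f \<circ> (g \<circ> (inv_into UNIV f \<circ> inv_into UNIV g))"
  by (metis bij_is_surj comp_assoc comp_id surj_iff)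

lemma word_maps_conj:
  assumes "\<sigma> \<in> word_maps" "f \<in> word_maps" "\<And>X. \<sigma> X \<circ> f X = h X \<circ> \<sigma> X"
  shows "h \<in> word_maps"
proof -
  have "h = (\<lambda>X. \<sigma> X \<circ> (f X \<circ> inv_into UNIV (\<sigma> X)))"
    using conjugate_eq[OF bij_word_maps[OF assms(1)] assms(3)] by (rule ext)
  also have "\<dots> \<in> word_maps" using assms by (intro word_maps_comp word_maps_inv)
  finally show ?thesis .
qed

lemma word_maps_conj':
  assumes "\<sigma> \<in> word_maps" "f \<in> word_maps" "\<And>X. \<sigma> X \<circ> h X = f X \<circ> \<sigma> X"
  shows "h \<in> word_maps"
proof -
  have "h = (\<lambda>X. inv_into UNIV (\<sigma> X) \<circ> (f X \<circ> \<sigma> X))"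
    using conjugate_eq'[OF bij_word_maps[OF assms(1)] assms(3)] by (rule ext)
  also have "\<dots> \<in> word_maps" using assms by (intro word_maps_comp word_maps_inv)
  finally show ?thesis .
qed

lemma word_maps_commutator:
  assumes "f \<in> word_maps" "g \<in> word_maps" "\<And>X. f X \<circ> g X = h X \<circ> (g X \<circ> f X)"
  shows "h \<in> word_maps"
proof -
  have "h = (\<lambda>X. f X \<circ> (g X \<circ> (inv_into UNIV (f X) \<circ> inv_into UNIV (g X))))"
    using commutator_eq[OF bij_word_maps[OF assms(1)] bij_word_maps[OF assms(2)] assms(3)] by (rule ext)
  also have "\<dots> \<in> word_maps" using assms by (intro word_maps_comp word_maps_inv)
  finally show ?thesis .
qed

lemma shift_subset: "U \<subseteq> residue_class M a \<Longrightarrow> shift t U \<subseteq> residue_class M (a + t)"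
  using shift_residue_class[of t M a] by (auto simp: shift_def)

lemma shift_shift_back: "shift (-1) (shift 1 W) = W"
  by (simp add: shift_def)

text \<open>
  A family of sets is definable if a single word produces, for every \<open>X\<close>, the 3-cycle based on its
  member at \<open>X\<close>. The residue class modulo 8 leaves enough room for the commutator calculations.
\<close>

definition definable :: "int \<Rightarrow> (nat set \<Rightarrow> int set) \<Rightarrow> bool" where
  "definable a U \<longleftrightarrow> (\<forall>X. U X \<subseteq> residue_class 8 a) \<and> (\<lambda>X. tricycle (U X)) \<in> word_maps"

lemma definable_residue_class: "definable a (\<lambda>X. residue_class 8 a)"
proof -
  have "residue_class 8 a = residue_class 8 (a mod 8)" unfolding residue_class_def by (auto; presburger)
  moreover have "tricycle (residue_class 8 (a mod 8)) = generator X (nat (a mod 8))" for X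
    by (simp add: generator_def nat_less_iff)
  ultimately show ?thesis using word_maps_generator[of "nat (a mod 8)"] by (simp add: definable_def)
qed

lemma definable_marked: "definable 5 marked"
  using word_maps_generator[of 8] marked_subset by (simp add: definable_def generator_def)

lemma definable_shift_1:
  assumes "definable a U" shows "definable (a + 1) (\<lambda>X. shift 1 (U X))"
proof -
  have "(\<lambda>X. tricycle (shift 1 (U X))) \<in> word_maps"
  proof (rule word_maps_conj)
    show "(\<lambda>X. tricycle (residue_class 8 a) \<circ> tricycle (residue_class 8 (a + 2))) \<in> word_maps"
      using word_maps_comp definable_residue_class unfolding definable_def by blast
    show "(\<lambda>X. tricycle (U X)) \<in> word_maps" using assms definable_def by blast
    show "(tricycle (residue_class 8 a) \<circ> tricycle (residue_class 8 (a + 2))) \<circ> tricycle (U X) =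
         tricycle (shift 1 (U X)) \<circ> (tricycle (residue_class 8 a) \<circ> tricycle (residue_class 8 (a + 2)))" for X
      by (rule tricycle_translate) (use assms in \<open>auto simp: definable_def\<close>)
  qed
  then show ?thesis using assms shift_subset[of _ 8 a 1] by (simp add: definable_def)
qed

lemma definable_shift_minus_1:
  assumes "definable a U" shows "definable (a - 1) (\<lambda>X. shift (-1) (U X))"
proof -
  have sub: "shift (-1) (U X) \<subseteq> residue_class 8 (a - 1)" for X
    using assms shift_subset[of _ 8 a "-1"] by (simp add: definable_def)
  have "(\<lambda>X. tricycle (shift (-1) (U X))) \<in> word_maps"
  proof (rule word_maps_conj')
    show "(\<lambda>X. tricycle (residue_class 8 (a - 1)) \<circ> tricycle (residue_class 8 (a - 1 + 2))) \<in> word_maps"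
      using word_maps_comp definable_residue_class unfolding definable_def by blast
    show "(\<lambda>X. tricycle (U X)) \<in> word_maps" using assms definable_def by blast
    have "shift 1 (shift (-1) (U X)) = U X" for X by (auto simp: shift_def)
    then show "(tricycle (residue_class 8 (a - 1)) \<circ> tricycle (residue_class 8 (a - 1 + 2))) \<circ> tricycle (shift (-1) (U X)) =
         tricycle (U X) \<circ> (tricycle (residue_class 8 (a - 1)) \<circ> tricycle (residue_class 8 (a - 1 + 2)))" for X
      using tricycle_translate[OF sub, of X] by simp
  qed
  with sub show ?thesis by (auto simp: definable_def)
qed

lemma definable_shift: "definable a U \<Longrightarrow> definable (a + t) (\<lambda>X. shift t (U X))"
proof (induction t rule: int_induct[of _ 0])
  case base
  then show ?case by (simp add: shift_def)
next
  case (step1 i)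
  have "shift 1 (shift i V) = shift (i + 1) V" for V by (auto simp: shift_def algebra_simps)
  with definable_shift_1[OF step1(2)[OF step1(3)]] show ?case by (simp add: add.assoc)
next
  case (step2 i)
  have "shift (-1) (shift i V) = shift (i - 1) V" for V by (auto simp: shift_def algebra_simps)
  with definable_shift_minus_1[OF step2(2)[OF step2(3)]] show ?case by (simp add: add_diff_eq)
qed

lemma definable_Int:
  assumes "definable a U" "definable a V" shows "definable a (\<lambda>X. U X \<inter> V X)"
proof -
  have sub: "U X \<subseteq> residue_class 8 a" "V X \<subseteq> residue_class 8 a" for X using assms by (auto simp: definable_def)
  have "(\<lambda>X. cyc3 (U X \<inter> V X) 0 3 2) \<in> word_maps"
  proof (rule word_maps_commutator)
    show "(\<lambda>X. tricycle (U X)) \<in> word_maps" "(\<lambda>X. tricycle (shift 2 (V X))) \<in> word_maps"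
      using assms definable_shift[OF assms(2), of 2] by (simp_all add: definable_def)
  qed (rule tricycle_commutator[OF sub], simp)
  from word_maps_comp[OF this this] have "(\<lambda>X. cyc3 (U X \<inter> V X) 0 2 3) \<in> word_maps"
    using sub cyc3_032_squared[of "U _ \<inter> V _" 8 a] by (simp add: le_infI1)
  then have "(\<lambda>X. tricycle (shift 1 (U X \<inter> V X))) \<in> word_maps"
  proof (rule word_maps_conj[rotated])
    show "(\<lambda>X. tricycle (residue_class 8 (a - 1))) \<in> word_maps" using definable_residue_class by (simp add: definable_def)
    show "tricycle (residue_class 8 (a - 1)) \<circ> cyc3 (U X \<inter> V X) 0 2 3 =
        tricycle (shift 1 (U X \<inter> V X)) \<circ> tricycle (residue_class 8 (a - 1))" for X
      using sub by (intro tricycle_restore) auto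
  qed
  then have "definable (a + 1) (\<lambda>X. shift 1 (U X \<inter> V X))"
    using sub shift_subset[of _ 8 a 1] by (simp add: definable_def le_infI1)
  from definable_shift_minus_1[OF this] show ?thesis
    by (simp only: shift_shift_back add_diff_cancel_right')
qed

lemma definable_Diff:
  assumes "definable a U" "definable a V" shows "definable a (\<lambda>X. U X - V X)"
proof -
  have sub: "U X \<subseteq> residue_class 8 a" "V X \<subseteq> residue_class 8 a" for X using assms by (auto simp: definable_def)
  have "(\<lambda>X. tricycle (residue_class 8 a - V X)) \<in> word_maps"
  proof -
    have "tricycle (residue_class 8 a - V X) = tricycle (residue_class 8 a) \<circ> (tricycle (V X) \<circ> tricycle (V X))" for X
    proof -
      have "tricycle (residue_class 8 a - V X) \<circ> tricycle (V X) = tricycle (residue_class 8 a)"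
        using tricycle_union[of "residue_class 8 a - V X" 8 a "V X"] sub(2)[of X]
        by (simp add: Un_absorb2 Un_absorb1 Int_commute Diff_disjoint)
      then have "tricycle (residue_class 8 a) \<circ> (tricycle (V X) \<circ> tricycle (V X)) =
          tricycle (residue_class 8 a - V X) \<circ> (tricycle (V X) \<circ> (tricycle (V X) \<circ> tricycle (V X)))"
        by (simp add: o_assoc)
      then show ?thesis using tricycle_cubed[OF sub(2)] by simp
    qed
    then show ?thesis using assms definable_residue_class by (auto simp: definable_def intro!: word_maps_comp)
  qed
  then have "definable a (\<lambda>X. residue_class 8 a - V X)" by (auto simp: definable_def)
  from definable_Int[OF assms(1) this] show ?thesis
    using sub by (simp add: Diff_eq Int_absorb2 flip: Int_assoc)
qed

lemma definable_INT: "finite I \<Longrightarrow> definable a U \<Longrightarrow> (\<And>i. i \<in> I \<Longrightarrow> definable a (V i)) \<Longrightarrow>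
    definable a (\<lambda>X. U X \<inter> (\<Inter>i \<in> I. V i X))"
proof (induction I rule: finite_induct)
  case (insert i I)
  then have "definable a (\<lambda>X. (U X \<inter> (\<Inter>i \<in> I. V i X)) \<inter> V i X)" by (intro definable_Int insert.IH) auto
  then show ?case by (simp add: Int_ac)
qed simp

lemma definable_diff_UN: "finite I \<Longrightarrow> definable a U \<Longrightarrow> (\<And>i. i \<in> I \<Longrightarrow> definable a (V i)) \<Longrightarrow>
    definable a (\<lambda>X. U X - (\<Union>i \<in> I. V i X))"
proof (induction I rule: finite_induct)
  case (insert i I)
  then have "definable a (\<lambda>X. (U X - (\<Union>i \<in> I. V i X)) - V i X)" by (intro definable_Diff insert.IH) auto
  moreover have "(U X - (\<Union>i \<in> I. V i X)) - V i X = U X - (\<Union>i \<in> insert i I. V i X)" for X by auto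
  ultimately show ?case by simp
qed simp

lemma nest_unique: "n \<in> nest k - nest (Suc k) \<Longrightarrow> n \<in> nest l - nest (Suc l) \<Longrightarrow> k = l"
  using nest_mono[of "Suc k" l] nest_mono[of "Suc l" k] by (cases k l rule: linorder_cases) auto

lemma marked_iff: "n \<in> nest k - nest (Suc k) \<Longrightarrow> k \<ge> 3 \<Longrightarrow> n \<in> marked X \<longleftrightarrow> k \<in> pattern X"
  unfolding marked_def using nest_unique by blast

lemma nest_add: "n + 2 ^ k * i \<in> nest k \<longleftrightarrow> n \<in> nest k"
proof -
  have "3 * (n + 2 ^ k * i) + 1 = (3 * n + 1) + 2 ^ k * (3 * i)" by (simp add: algebra_simps)
  then show ?thesis unfolding nest_def by (metis (mono_tags, lifting) dvd_add_left_iff dvd_triv_left mem_Collect_eq)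
qed

lemma nest_add_stable: "n \<in> nest k - nest (Suc k) \<Longrightarrow> n + 2 ^ Suc k * i \<in> nest k - nest (Suc k)"
  using nest_add[of n "Suc k" i] nest_add[of n k "2 * i"] by (simp add: algebra_simps)

text \<open>
  Along a short arithmetic progression with difference \<open>2 ^ k\<close> the exact exponent of two in
  \<open>3 * n + 1\<close> takes each of the values \<open>k\<close>, \<open>k + 1\<close> and \<open>k + 2\<close>.
\<close>

lemma nest_reach:
  assumes "n \<in> nest k" "j \<le> 2"
  shows "\<exists>i \<in> {0..<8}. n + 2 ^ k * i \<in> nest (k + j) - nest (Suc (k + j))"
proof -
  obtain q where q: "3 * n + 1 = 2 ^ k * q" using assms by (auto simp: nest_def dvd_def)
  \<comment> \<open>As \<open>3 * 3\<close> is one modulo 8, this solves \<open>q + 3 * i = 2 ^ j\<close> modulo 8.\<close>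
  define i where "i = (3 * (2 ^ j - q)) mod (8::int)"
  define m where "m = (3 * (2 ^ j - q)) div (8::int)"
  have lin: "b + 3 * c = e + 8 * (e - b - 3 * a)" if "8 * a + c = 3 * (e - b)" for a b c e :: int
  proof -
    have c: "c = 3 * (e - b) - 8 * a" using that by linarith
    show ?thesis unfolding c by (simp add: algebra_simps)
  qed
  have "8 * m + i = 3 * (2 ^ j - q)" unfolding i_def m_def by (rule mult_div_mod_eq)
  then have "q + 3 * i = 2 ^ j + 8 * (2 ^ j - q - 3 * m)" by (rule lin)
  then obtain s where s: "q + 3 * i = 2 ^ j + 8 * s" by blast
  have "\<exists>r. q + 3 * i = 2 ^ j * r \<and> odd r"
  proof -
    consider "j = 0" | "j = 1" | "j = 2" using assms(2) by linarith
    then show ?thesis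
    proof cases
      case 1
      then have "q + 3 * i = 2 ^ j * (1 + 8 * s)" "odd (1 + 8 * s)" using s by simp_all
      then show ?thesis by blast
    next
      case 2
      then have "q + 3 * i = 2 ^ j * (1 + 4 * s)" "odd (1 + 4 * s)" using s by simp_all
      then show ?thesis by blast
    next
      case 3
      then have "q + 3 * i = 2 ^ j * (1 + 2 * s)" "odd (1 + 2 * s)" using s by simp_all
      then show ?thesis by blast
    qed
  qed
  then obtain r where r: "q + 3 * i = 2 ^ j * r" "odd r" by blast
  have "3 * (n + 2 ^ k * i) + 1 = 2 ^ k * (q + 3 * i)" using q by (simp add: algebra_simps)
  also have "\<dots> = 2 ^ (k + j) * r" using r by (simp add: power_add)
  finally have e: "3 * (n + 2 ^ k * i) + 1 = 2 ^ (k + j) * r" .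
  have "n + 2 ^ k * i \<in> nest (k + j) - nest (Suc (k + j))"
  proof -
    have "(2::int) ^ (k + j) dvd 2 ^ (k + j) * r" "\<not> (2::int) ^ (k + j) * 2 dvd 2 ^ (k + j) * r"
      using r(2) by simp_all
    then show ?thesis unfolding nest_def by (simp only: Diff_iff mem_Collect_eq e power_Suc2) blast
  qed
  moreover have "i \<in> {0..<8}" by (simp add: i_def)
  ultimately show ?thesis by blast
qed

text \<open>
  Together with \<open>none_marked\<close> this collects the points of \<open>nest k\<close> from which the Toeplitz sequence
  is constant along a short progression. These are exactly the points that are not in
  \<open>nest (Suc k)\<close>, and which of the two sets is nonempty reveals whether \<open>k\<close> belongs to the
  pattern.
\<close>

definition all_marked :: "nat \<Rightarrow> nat set \<Rightarrow> int set" where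
  "all_marked k X = nest k \<inter> (\<Inter>i \<in> {0..<8}. shift (- (2 ^ Suc k * i)) (marked X))"

definition none_marked :: "nat \<Rightarrow> nat set \<Rightarrow> int set" where
  "none_marked k X = nest k - (\<Union>i \<in> {0..<8}. shift (- (2 ^ Suc k * i)) (marked X))"

lemma mem_all_marked: "n \<in> all_marked k X \<longleftrightarrow> n \<in> nest k \<and> (\<forall>i \<in> {0..<8}. n + 2 ^ Suc k * i \<in> marked X)"
  unfolding all_marked_def by (simp only: Int_iff INT_iff mem_shift diff_minus_eq_add)

lemma mem_none_marked: "n \<in> none_marked k X \<longleftrightarrow> n \<in> nest k \<and> (\<forall>i \<in> {0..<8}. n + 2 ^ Suc k * i \<notin> marked X)"
proof -
  have neg: "\<not> (\<exists>i \<in> I. P i) \<longleftrightarrow> (\<forall>i \<in> I. \<not> P i)" for I :: "int set" and P by blast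
  show ?thesis unfolding none_marked_def Diff_iff UN_iff mem_shift diff_minus_eq_add neg by (rule refl)
qed

lemma marked_oscillates:
  assumes "k \<ge> 3" "n \<in> nest k"
  shows "\<exists>i \<in> {0..<8}. n + 2 ^ k * i \<in> marked X" "\<exists>i \<in> {0..<8}. n + 2 ^ k * i \<notin> marked X"
proof -
  \<comment> \<open>One of \<open>k, k + 1, k + 2\<close> is in every pattern and one is in none.\<close>
  consider "k mod 3 = 0" | "k mod 3 = 1" | "k mod 3 = 2" by linarith
  then obtain j l where j: "j \<le> 2" "(k + j) mod 3 = 1" and l: "l \<le> 2" "(k + l) mod 3 = 0"
  proof cases
    case 1
    then have "(k + 1) mod 3 = 1" "(k + 0) mod 3 = 0" by (simp_all add: mod_Suc)
    then show thesis using that[of 1 0] by simp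
  next
    case 2
    then have "(k + 0) mod 3 = 1" "(k + 2) mod 3 = 0" by (simp_all add: mod_Suc)
    then show thesis using that[of 0 2] by simp
  next
    case 3
    then have "(k + 2) mod 3 = 1" "(k + 1) mod 3 = 0" by (simp_all add: mod_Suc)
    then show thesis using that[of 2 1] by simp
  qed
  show "\<exists>i \<in> {0..<8}. n + 2 ^ k * i \<in> marked X"
    using nest_reach[OF assms(2) j(1)] marked_iff[of _ "k + j" X] assms j(2) unfolding pattern_def by fastforce
  show "\<exists>i \<in> {0..<8}. n + 2 ^ k * i \<notin> marked X"
    using nest_reach[OF assms(2) l(1)] marked_iff[of _ "k + l" X] assms l(2) unfolding pattern_def by fastforce
qed

lemma all_marked_eq:
  assumes "k \<ge> 3" shows "all_marked k X = (if k \<in> pattern X then nest k - nest (Suc k) else {})"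
proof -
  have "n \<in> all_marked k X \<longleftrightarrow> n \<in> nest k - nest (Suc k) \<and> k \<in> pattern X" for n
  proof (cases "n \<in> nest (Suc k)")
    case True
    then show ?thesis using marked_oscillates(2)[of "Suc k" n X] assms unfolding mem_all_marked by auto
  next
    case False
    then have "n + 2 ^ Suc k * i \<in> marked X \<longleftrightarrow> k \<in> pattern X" if "n \<in> nest k" for i
      using that nest_add_stable[of n k] marked_iff[of _ k X] assms by blast
    moreover have "\<exists>i. i \<in> {0..<8::int}" by (rule exI[of _ 0]) simp
    ultimately show ?thesis using False unfolding mem_all_marked by blast
  qed
  then show ?thesis by auto
qed

lemma none_marked_eq:
  assumes "k \<ge> 3" shows "none_marked k X = (if k \<in> pattern X then {} else nest k - nest (Suc k))"
proof -
  have "n \<in> none_marked k X \<longleftrightarrow> n \<in> nest k - nest (Suc k) \<and> k \<notin> pattern X" for n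
  proof (cases "n \<in> nest (Suc k)")
    case True
    then show ?thesis using marked_oscillates(1)[of "Suc k" n X] assms unfolding mem_none_marked by auto
  next
    case False
    then have "n + 2 ^ Suc k * i \<in> marked X \<longleftrightarrow> k \<in> pattern X" if "n \<in> nest k" for i
      using that nest_add_stable[of n k] marked_iff[of _ k X] assms by blast
    moreover have "\<exists>i. i \<in> {0..<8::int}" by (rule exI[of _ 0]) simp
    ultimately show ?thesis using False unfolding mem_none_marked by blast
  qed
  then show ?thesis by auto
qed

lemma definable_shift_marked: "k \<ge> 3 \<Longrightarrow> definable 5 (\<lambda>X. shift (- (2 ^ k * i)) (marked X))"
proof -
  assume "k \<ge> 3"
  then have "(8::int) dvd 2 ^ k" using le_imp_power_dvd[of 3 k "2::int"] by simp
  then obtain t where "2 ^ k = 8 * (t::int)" by (elim dvdE)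
  then have "residue_class 8 (5 + - (2 ^ k * i)) = residue_class 8 (5 + - (8 * (t * i)))" by (simp add: mult.assoc)
  also have "\<dots> = residue_class 8 5" unfolding residue_class_def by (rule Collect_cong) presburger
  finally have "residue_class 8 (5 + - (2 ^ k * i)) = residue_class 8 5" .
  with definable_shift[OF definable_marked, of "- (2 ^ k * i)"] show ?thesis by (simp add: definable_def)
qed

lemma definable_all_none_marked:
  assumes "k \<ge> 3" "definable 5 (\<lambda>X. nest k)" shows "definable 5 (all_marked k)" "definable 5 (none_marked k)"
  using assms definable_shift_marked[of "Suc k"]
  unfolding all_marked_def[abs_def] none_marked_def[abs_def]
  by (intro definable_INT definable_diff_UN; simp)+

text \<open>
  The next neighbourhood is what remains of the present one after removal of the points of constancy.
  Both sets of points of constancy are removed, although one of them is empty, so that the defining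
  word does not depend on \<open>X\<close>.
\<close>

lemma definable_nest: "k \<ge> 3 \<Longrightarrow> definable 5 (\<lambda>X. nest k)"
proof (induction k rule: nat_induct_at_least)
  case base
  then show ?case using definable_residue_class by (simp add: nest_3)
next
  case (Suc k)
  then have "definable 5 (\<lambda>X. nest k - all_marked k X - none_marked k X)" by (intro definable_Diff definable_all_none_marked)
  moreover have "nest k - all_marked k X - none_marked k X = nest (Suc k)" for X
    using Suc nest_mono[of k "Suc k"] by (auto simp: all_marked_eq none_marked_eq)
  ultimately show ?case by simp
qed

lemma nest_nonempty: "nest k \<noteq> {}"
proof (induction k)
  case 0
  then show ?case by (auto simp: nest_def)
next
  case (Suc k)
  then obtain n q :: int where q: "3 * n + 1 = 2 ^ k * q" by (auto simp: nest_def dvd_def)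
  show ?case
  proof (cases "even q")
    case True
    then have "n \<in> nest (Suc k)" using q by (auto simp: nest_def elim!: evenE)
    then show ?thesis by blast
  next
    case False
    have "3 * (n + 2 ^ k) + 1 = 2 ^ k * (q + 3)" using q by (simp add: algebra_simps)
    then have "n + 2 ^ k \<in> nest (Suc k)" using False by (simp add: nest_def mult.commute[of 2])
    then show ?thesis by blast
  qed
qed

lemma nest_eq_residue_class: "c \<in> nest k \<Longrightarrow> nest k = residue_class (2 ^ k) c"
proof -
  assume c: "c \<in> nest k"
  have "coprime ((2::int) ^ k) 3" by simp
  then have "2 ^ k dvd 3 * (n - c) \<longleftrightarrow> 2 ^ k dvd n - c" for n
    by (simp only: coprime_dvd_mult_right_iff)
  moreover have "3 * n + 1 = (3 * c + 1) + 3 * (n - c)" for n by simp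
  ultimately show ?thesis using c unfolding nest_def residue_class_def
    by (metis (no_types, lifting) dvd_add_right_iff mem_Collect_eq)
qed

lemma residue_class_mono: "M dvd N \<Longrightarrow> residue_class N a \<subseteq> residue_class M a"
  unfolding residue_class_def using dvd_trans by blast

text \<open>
  A residue class modulo \<open>2 ^ k\<close> is a translate of \<open>nest k\<close>.
\<close>

lemma definable_residue_class_power: "k \<ge> 3 \<Longrightarrow> definable a (\<lambda>X. residue_class (2 ^ k) a)"
proof -
  assume k: "k \<ge> 3"
  then have "(8::int) dvd 2 ^ k" using le_imp_power_dvd[of 3 k "2::int"] by simp
  from residue_class_mono[OF this] have sub: "residue_class (2 ^ k) a \<subseteq> residue_class 8 a" .
  obtain c where "c \<in> nest k" using nest_nonempty by blast
  then have "definable (5 + (a - c)) (\<lambda>X. shift (a - c) (residue_class (2 ^ k) c))"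
    using definable_shift[OF definable_nest[OF k]] nest_eq_residue_class by simp
  with sub show ?thesis by (simp add: definable_def shift_residue_class)
qed

lemma nest_Suc_ne: "nest k \<noteq> nest (Suc k)"
proof -
  obtain c where "c \<in> nest k" using nest_nonempty by blast
  with nest_reach[of c k 0] show ?thesis by auto
qed

text \<open>
  The word that defines \<open>all_marked k\<close> evaluates to the identity exactly if this set is empty, hence
  decides whether \<open>k\<close> belongs to the pattern.
\<close>

lemma relations_determine:
  assumes "\<And>w. eval_word X w = id \<longleftrightarrow> eval_word Y w = id"
  shows "X = Y"
proof -
  have tricycle_id: "tricycle U = id \<longleftrightarrow> U = {}" for U
    by (auto simp: tricycle_def cyc3_def fun_eq_iff)
  have pattern: "k \<in> pattern X \<longleftrightarrow> k \<in> pattern Y" if k: "k \<ge> 3" for k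
  proof -
    obtain w where w: "\<And>Z. tricycle (all_marked k Z) = eval_word Z w"
      using definable_all_none_marked(1)[OF k definable_nest[OF k]] unfolding definable_def word_maps_def by blast
    have "k \<in> pattern Z \<longleftrightarrow> eval_word Z w \<noteq> id" for Z
      using tricycle_id all_marked_eq[OF k] w[symmetric] nest_Suc_ne[of k] nest_mono[of k "Suc k"] by auto
    with assms show ?thesis by blast
  qed
  show ?thesis
  proof (rule Set.set_eqI)
    fix m :: nat
    have "(3 * m + 5) mod 3 = 2" "(3 * m + 5) div 3 = m + 1" by presburger+
    then show "m \<in> X \<longleftrightarrow> m \<in> Y" using pattern[of "3 * m + 5"] by (simp add: pattern_def)
  qed
qed

section \<open>The permutation groups and their normal subgroups\<close>

definition Gamma :: "nat set \<Rightarrow> (int \<Rightarrow> int) set" where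
  "Gamma X = range (eval_word X)"

lemma Gamma_word_maps: "f \<in> word_maps \<Longrightarrow> f X \<in> Gamma X"
  unfolding word_maps_def Gamma_def by auto

lemma Gamma_wordsE: "g \<in> Gamma X \<Longrightarrow> \<exists>f \<in> word_maps. g = f X"
  unfolding word_maps_def Gamma_def by auto

lemma Gamma_id: "id \<in> Gamma X"
  unfolding Gamma_def by (metis eval_word.simps(1) rangeI)

lemma Gamma_comp: "f \<in> Gamma X \<Longrightarrow> g \<in> Gamma X \<Longrightarrow> f \<circ> g \<in> Gamma X"
  unfolding Gamma_def using eval_word_append[of X, symmetric] by auto

lemma Gamma_inv: "f \<in> Gamma X \<Longrightarrow> inv_into UNIV f \<in> Gamma X"
  using Gamma_wordsE[of f X] word_maps_inv Gamma_word_maps by blast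

lemma Gamma_bij: "f \<in> Gamma X \<Longrightarrow> bij f"
  unfolding Gamma_def using bij_eval_word by auto

lemma Gamma_definable: "definable a U \<Longrightarrow> tricycle (U X) \<in> Gamma X"
  unfolding definable_def using Gamma_word_maps[of "\<lambda>X. tricycle (U X)"] by simp

lemma Gamma_tricycle_residue_class: "k \<ge> 3 \<Longrightarrow> tricycle (residue_class (2 ^ k) a) \<in> Gamma X"
  using Gamma_definable[OF definable_residue_class_power] by simp

text \<open>
  The displacement at every integer recurs along an arithmetic progression whose difference is a power
  of two; this power may depend on the integer.
\<close>

definition toeplitz :: "(int \<Rightarrow> int) \<Rightarrow> bool" where
  "toeplitz g \<longleftrightarrow> (\<forall>n. \<exists>k. \<forall>t. g (n + 2 ^ k * t) = g n + 2 ^ k * t)"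

lemma toeplitz_power_mono:
  fixes g :: "int \<Rightarrow> int"
  assumes "\<And>t. g (n + 2 ^ k * t) = g n + 2 ^ k * t" "k \<le> l"
  shows "g (n + 2 ^ l * t) = g n + 2 ^ l * t"
proof -
  have "(2::int) ^ l * t = 2 ^ k * (2 ^ (l - k) * t)"
    using assms(2) by (simp add: power_add[symmetric] mult.assoc[symmetric])
  then show ?thesis using assms(1)[of "2 ^ (l - k) * t"] by (simp only:)
qed

lemma toeplitz_comp:
  assumes "toeplitz f" "toeplitz g" shows "toeplitz (f \<circ> g)"
  unfolding toeplitz_def
proof
  fix n
  obtain k where k: "\<And>t. g (n + 2 ^ k * t) = g n + 2 ^ k * t" using assms toeplitz_def by blast
  obtain l where l: "\<And>t. f (g n + 2 ^ l * t) = f (g n) + 2 ^ l * t" using assms toeplitz_def by blast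
  have "(f \<circ> g) (n + 2 ^ max k l * t) = (f \<circ> g) n + 2 ^ max k l * t" for t
    using toeplitz_power_mono[of g n, OF k, of "max k l"] toeplitz_power_mono[of f "g n", OF l, of "max k l"] by simp
  then show "\<exists>k. \<forall>t. (f \<circ> g) (n + 2 ^ k * t) = (f \<circ> g) n + 2 ^ k * t" by blast
qed

lemma toeplitz_tricycle:
  assumes "\<And>n. \<exists>k. \<forall>t. n + 2 ^ k * t \<in> U \<longleftrightarrow> n \<in> U"
  shows "toeplitz (tricycle U)"
  unfolding toeplitz_def
proof
  fix n
  obtain k0 where k0: "\<And>t. n + 2 ^ k0 * t \<in> U \<longleftrightarrow> n \<in> U" using assms by blast
  obtain k1 where k1: "\<And>t. (n - 1) + 2 ^ k1 * t \<in> U \<longleftrightarrow> n - 1 \<in> U" using assms by blast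
  obtain k2 where k2: "\<And>t. (n - 2) + 2 ^ k2 * t \<in> U \<longleftrightarrow> n - 2 \<in> U" using assms by blast
  define k where "k = k0 + k1 + k2"
  have p: "(2::int) ^ k * t = 2 ^ k0 * (2 ^ (k1 + k2) * t)" "(2::int) ^ k * t = 2 ^ k1 * (2 ^ (k0 + k2) * t)"
    "(2::int) ^ k * t = 2 ^ k2 * (2 ^ (k0 + k1) * t)" for t
    by (simp_all add: k_def power_add)
  have "n + 2 ^ k * t \<in> U \<longleftrightarrow> n \<in> U" for t unfolding p(1) by (rule k0)
  moreover have "n + 2 ^ k * t - 1 \<in> U \<longleftrightarrow> n - 1 \<in> U" for t
    using k1[of "2 ^ (k0 + k2) * t"] unfolding p(2)[symmetric] diff_add_eq .
  moreover have "n + 2 ^ k * t - 2 \<in> U \<longleftrightarrow> n - 2 \<in> U" for t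
    using k2[of "2 ^ (k0 + k1) * t"] unfolding p(3)[symmetric] diff_add_eq .
  ultimately have "tricycle U (n + 2 ^ k * t) = tricycle U n + 2 ^ k * t" for t
    unfolding tricycle_def cyc3_def by simp
  then show "\<exists>k. \<forall>t. tricycle U (n + 2 ^ k * t) = tricycle U n + 2 ^ k * t" by blast
qed

lemma nest_exact: "\<exists>k. n \<in> nest k - nest (Suc k)"
proof -
  let ?m = "3 * n + 1"
  have "?m \<noteq> 0" by presburger
  moreover have "\<bar>?m\<bar> < 2 ^ nat \<bar>?m\<bar>"
    using of_nat_less_two_power[of "nat \<bar>?m\<bar>", where 'a = int] by simp
  ultimately have "n \<notin> nest (nat \<bar>?m\<bar>)"
    unfolding nest_def using dvd_imp_le_int[of ?m "2 ^ nat \<bar>?m\<bar>"] by auto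
  moreover have "n \<in> nest 0" by (simp add: nest_def)
  ultimately show ?thesis using ex_least_nat_less[of "\<lambda>k. n \<notin> nest k"] by auto
qed

lemma toeplitz_generator: "toeplitz (generator X i)"
proof (cases "i < 8")
  case True
  have "n + 2 ^ 3 * t \<in> residue_class 8 a \<longleftrightarrow> n \<in> residue_class 8 a" for n t a
  proof -
    have "8 dvd n + 8 * t - a \<longleftrightarrow> 8 dvd n - a" by presburger
    then show ?thesis by (simp add: residue_class_def)
  qed
  then have "\<exists>k. \<forall>t. n + 2 ^ k * t \<in> residue_class 8 (int i) \<longleftrightarrow> n \<in> residue_class 8 (int i)" for n by blast
  with True show ?thesis unfolding generator_def by (simp add: toeplitz_tricycle)
next
  case False
  have "\<exists>k. \<forall>t. n + 2 ^ k * t \<in> marked X \<longleftrightarrow> n \<in> marked X" for n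
  proof -
    obtain k where k: "n \<in> nest k - nest (Suc k)" using nest_exact by blast
    have S: "m \<in> marked X \<longleftrightarrow> k \<ge> 3 \<and> k \<in> pattern X" if "m \<in> nest k - nest (Suc k)" for m
      using that nest_unique unfolding marked_def by blast
    have "n + 2 ^ Suc k * t \<in> marked X \<longleftrightarrow> n \<in> marked X" for t
      using S[OF k] S[OF nest_add_stable[OF k]] by blast
    then show ?thesis by blast
  qed
  with False show ?thesis unfolding generator_def by (simp add: toeplitz_tricycle)
qed

lemma Gamma_toeplitz: "g \<in> Gamma X \<Longrightarrow> toeplitz g"
proof -
  have "toeplitz (eval_word X w)" for w
  proof (induction w)
    case Nil
    then show ?case by (simp add: toeplitz_def)
  next
    case (Cons i w)
    then show ?case by (simp only: eval_word.simps) (rule toeplitz_comp[OF toeplitz_generator])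
  qed
  then show "g \<in> Gamma X \<Longrightarrow> toeplitz g" unfolding Gamma_def by blast
qed

definition bounded_disp :: "(int \<Rightarrow> int) \<Rightarrow> bool" where
  "bounded_disp g \<longleftrightarrow> (\<exists>C. \<forall>n. \<bar>g n - n\<bar> \<le> C)"

lemma Gamma_bounded_disp: "g \<in> Gamma X \<Longrightarrow> bounded_disp g"
proof -
  have "\<bar>eval_word X w n - n\<bar> \<le> 2 * int (length w)" for w n
  proof (induction w)
    case (Cons i w)
    have "\<bar>generator X i m - m\<bar> \<le> 2" for m by (auto simp: generator_def tricycle_def cyc3_def)
    from this[of "eval_word X w n"] Cons show ?case by simp
  qed simp
  then show "g \<in> Gamma X \<Longrightarrow> bounded_disp g" unfolding Gamma_def bounded_disp_def by blast
qed

abbreviation periodic_cycle :: "int \<Rightarrow> int \<Rightarrow> int \<Rightarrow> int \<Rightarrow> int \<Rightarrow> int" where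
  "periodic_cycle M i j k \<equiv> cyc3 (residue_class M 0) i j k"

lemma tricycle_residue_class: "tricycle (residue_class M a) = periodic_cycle M a (a + 1) (a + 2)"
  using tricycle_residue_class_shift[of M 0 a] by (simp add: add.commute)

definition conjugate_in :: "nat set \<Rightarrow> (int \<Rightarrow> int) \<Rightarrow> (int \<Rightarrow> int) \<Rightarrow> bool" where
  "conjugate_in X f h \<longleftrightarrow> (\<exists>\<sigma> \<in> Gamma X. \<sigma> \<circ> f = h \<circ> \<sigma>)"

lemma conjugate_in_refl: "conjugate_in X f f"
  unfolding conjugate_in_def using Gamma_id by (intro bexI[of _ id]) auto

lemma conjugate_in_trans: assumes "conjugate_in X f g" "conjugate_in X g h" shows "conjugate_in X f h"
proof -
  from assms obtain \<sigma> \<tau> where "\<sigma> \<in> Gamma X" "\<tau> \<in> Gamma X" "\<sigma> \<circ> f = g \<circ> \<sigma>" "\<tau> \<circ> g = h \<circ> \<tau>"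
    unfolding conjugate_in_def by blast
  then have "(\<tau> \<circ> \<sigma>) \<circ> f = h \<circ> (\<tau> \<circ> \<sigma>)" by (metis comp_assoc)
  with \<open>\<sigma> \<in> Gamma X\<close> \<open>\<tau> \<in> Gamma X\<close> show ?thesis unfolding conjugate_in_def using Gamma_comp by blast
qed

lemma periodic_cycle_consecutive_at:
  assumes "P \<subseteq> {x..<x + M}" "{p, p + 1, p + 2} \<subseteq> P" "u \<in> residue_class M 0" "q \<in> P"
  shows "periodic_cycle M p (p + 1) (p + 2) (u + q) =
    u + (if q = p then p + 1 else if q = p + 1 then p + 2 else if q = p + 2 then p else q)"
  using cyc3_at[OF spread_residue_class_interval[OF assms(1)] subset_refl assms(3), of p "p + 1" "p + 2" q] assms
  by simp

text \<open>
  Conjugation by the 3-cycle on \<open>p, p + 1, p + 2\<close> moves an entry \<open>p\<close> of another cycle to \<open>p + 1\<close> and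
  keeps the other entries, provided that none of them is in the way.
\<close>

lemma conjugate_in_step:
  assumes M: "M = 2 ^ K" "K \<ge> 3" and P: "{i, j, k, p, p + 1, p + 2} \<subseteq> {x..<x + M}"
    and f: "\<And>q. f q = (if q = p then p + 1 else q)"
    and ne: "p + 1 \<notin> {i, j, k}" "p + 2 \<notin> {i, j, k}"
  shows "conjugate_in X (periodic_cycle M i j k) (periodic_cycle M (f i) (f j) (f k))"
proof -
  let ?\<sigma> = "periodic_cycle M p (p + 1) (p + 2)"
  have G: "?\<sigma> \<in> Gamma X" using Gamma_tricycle_residue_class[OF M(2), of p X] unfolding M(1) tricycle_residue_class .
  have "?\<sigma> (u + q) = u + f q" if "u \<in> residue_class M 0" "q \<in> {i, j, k}" for u q
    using periodic_cycle_consecutive_at[OF P _ that(1), of p q] that(2) ne unfolding f by auto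
  then have "?\<sigma> \<circ> periodic_cycle M i j k = periodic_cycle M (f i) (f j) (f k) \<circ> ?\<sigma>"
    by (intro cyc3_conj bij_is_inj Gamma_bij[OF G]) simp
  with G show ?thesis unfolding conjugate_in_def by blast
qed

text \<open>
  First the third entry and then the second entry walk to their destinations.
\<close>

lemma conjugate_in_spread:
  assumes M: "M = 2 ^ K" "K \<ge> 3" and "i < j" "j + 2 \<le> k" "k \<le> i + M - 2"
  shows "conjugate_in X (tricycle (residue_class M i)) (periodic_cycle M i j k)"
proof -
  have "conjugate_in X (periodic_cycle M i (i + 1) (i + 2)) (periodic_cycle M i (i + 1) l)" if "i + 2 \<le> l" "l \<le> i + M - 2" for l
    using that
  proof (induction l rule: int_ge_induct)
    case (step l)
    have "conjugate_in X (periodic_cycle M i (i + 1) l) (periodic_cycle M i (i + 1) (l + 1))"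
      using conjugate_in_step[OF M, where p = l and x = i and i = i and j = "i + 1" and k = l
          and f = "\<lambda>q. if q = l then l + 1 else q" and X = X] step by simp
    with step show ?case using conjugate_in_trans by simp
  qed (rule conjugate_in_refl)
  then have 1: "conjugate_in X (periodic_cycle M i (i + 1) (i + 2)) (periodic_cycle M i (i + 1) k)" using assms by simp
  have "conjugate_in X (periodic_cycle M i (i + 1) k) (periodic_cycle M i l k)" if "i + 1 \<le> l" "l + 2 \<le> k" for l
    using that
  proof (induction l rule: int_ge_induct)
    case (step l)
    have "conjugate_in X (periodic_cycle M i l k) (periodic_cycle M i (l + 1) k)"
      using conjugate_in_step[OF M, where p = l and x = i and i = i and j = l and k = k
          and f = "\<lambda>q. if q = l then l + 1 else q" and X = X] step assms by simp
    with step show ?case using conjugate_in_trans by simp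
  qed (rule conjugate_in_refl)
  with 1 show ?thesis using assms conjugate_in_trans unfolding tricycle_residue_class by simp
qed

lemma spread_periodic_cycle:
  assumes "i < j" "j < k" "k < i + M" shows "spread (residue_class M 0) {i, j, k}"
  by (rule spread_residue_class_interval[of _ i]) (use assms in auto)

lemma Gamma_periodic_cycle:
  assumes M: "M = 2 ^ K" "K \<ge> 3" and ijk: "i < j" "j + 2 \<le> k" "k \<le> i + M - 2"
  shows "periodic_cycle M i j k \<in> Gamma X" "periodic_cycle M i k j \<in> Gamma X" "periodic_cycle M j i k \<in> Gamma X"
proof -
  have sp: "spread (residue_class M 0) {i, j, k}" by (rule spread_periodic_cycle) (use ijk in auto)
  obtain \<sigma> where \<sigma>: "\<sigma> \<in> Gamma X" "\<sigma> \<circ> tricycle (residue_class M i) = periodic_cycle M i j k \<circ> \<sigma>"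
    using conjugate_in_spread[OF M ijk] unfolding conjugate_in_def by blast
  show 1: "periodic_cycle M i j k \<in> Gamma X"
    using conjugate_eq[OF Gamma_bij[OF \<sigma>(1)] \<sigma>(2)] Gamma_comp Gamma_inv \<sigma>(1) Gamma_tricycle_residue_class[OF M(2)] M(1) by simp
  from Gamma_comp[OF this this] show 2: "periodic_cycle M i k j \<in> Gamma X"
    using cyc3_squared[OF sp] ijk by simp
  have sp': "spread (residue_class M 0) {j, i, k}" using sp by (simp add: insert_commute)
  show "periodic_cycle M j i k \<in> Gamma X" using 2 cyc3_rotate[OF sp'] ijk by simp
qed

locale normal_subset =
  fixes X :: "nat set" and N :: "(int \<Rightarrow> int) set"
  assumes N_sub: "N \<subseteq> Gamma X"
    and N_id: "id \<in> N"
    and N_comp: "\<And>f g. f \<in> N \<Longrightarrow> g \<in> N \<Longrightarrow> f \<circ> g \<in> N"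
    and N_inv: "\<And>f. f \<in> N \<Longrightarrow> inv_into UNIV f \<in> N"
    and N_conjugate: "\<And>\<sigma> f. \<sigma> \<in> Gamma X \<Longrightarrow> f \<in> N \<Longrightarrow> \<sigma> \<circ> (f \<circ> inv_into UNIV \<sigma>) \<in> N"
begin

lemma N_bij: "f \<in> N \<Longrightarrow> bij f"
  using N_sub Gamma_bij by blast

lemma N_conj: "\<sigma> \<in> Gamma X \<Longrightarrow> f \<in> N \<Longrightarrow> \<sigma> \<circ> f = h \<circ> \<sigma> \<Longrightarrow> h \<in> N"
  using conjugate_eq[OF Gamma_bij] N_conjugate by metis

lemma N_conj': 
  assumes "\<sigma> \<in> Gamma X" "f \<in> N" "\<sigma> \<circ> h = f \<circ> \<sigma>" shows "h \<in> N"
proof -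
  have "inv_into UNIV (inv_into UNIV \<sigma>) = \<sigma>" using Gamma_bij[OF assms(1)] by (rule inv_inv_eq)
  then show ?thesis
    using N_conjugate[OF Gamma_inv[OF assms(1)] assms(2)] conjugate_eq'[OF Gamma_bij[OF assms(1)] assms(3)] by simp
qed

lemma N_conjugate_in: "f \<in> N \<Longrightarrow> conjugate_in X h f \<Longrightarrow> h \<in> N"
  unfolding conjugate_in_def using N_conj' by blast

lemma N_commutator:
  assumes "f \<in> Gamma X" "g \<in> N" "f \<circ> g = h \<circ> (g \<circ> f)" shows "h \<in> N"
proof -
  have "h = (f \<circ> (g \<circ> inv_into UNIV f)) \<circ> inv_into UNIV g"
    using commutator_eq[OF Gamma_bij[OF assms(1)] N_bij[OF assms(2)] assms(3)] by (simp add: o_assoc)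
  then show ?thesis using N_comp N_conjugate N_inv assms by simp
qed

lemma N_commutator':
  assumes "f \<in> N" "g \<in> Gamma X" "f \<circ> g = h \<circ> (g \<circ> f)" shows "h \<in> N"
proof -
  have b: "bij f" "bij g" using N_bij Gamma_bij assms by auto
  have "h = f \<circ> (g \<circ> (inv_into UNIV f \<circ> inv_into UNIV g))" using commutator_eq[OF b assms(3)] .
  then show ?thesis using N_comp N_conjugate[OF assms(2) N_inv[OF assms(1)]] assms(1) by (simp add: o_assoc[symmetric])
qed

text \<open>
  Choose \<open>n0\<close> that \<open>g\<close> moves, by \<open>d\<close> say. Then \<open>g\<close> translates the residue class of \<open>n0\<close> modulo some
  power of two \<open>P > \<bar>d\<bar>\<close> to a disjoint class. Take two elements that are supported in the class of
  \<open>n0\<close> and multiply the first by the conjugate of its inverse under \<open>g\<close>. The product lies in the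
  normal subgroup, and the new factor has disjoint support, so that the commutator with the second
  element remains the same. Hence this commutator is in the normal subgroup. For cycles modulo
  \<open>8 * P\<close> whose entries differ by multiples of \<open>P\<close> it is a 3-cycle.
\<close>

lemma N_tricycle_seed:
  assumes g: "g \<in> N" "g \<noteq> id"
  shows "\<exists>K \<ge> 3. \<exists>a. tricycle (residue_class (2 ^ K) a) \<in> N"
proof -
  obtain n0 where n0: "g n0 \<noteq> n0" using g by (auto simp: fun_eq_iff)
  obtain k0 where k0: "\<And>t. g (n0 + 2 ^ k0 * t) = g n0 + 2 ^ k0 * t"
    using Gamma_toeplitz[of g X] g N_sub toeplitz_def by blast
  define d where "d = g n0 - n0"
  define k where "k = k0 + nat \<bar>d\<bar> + 1"
  define P :: int where "P = 2 ^ k"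
  define K where "K = k + 3"
  define M where "M = 8 * P"
  have M: "M = 2 ^ K" "K \<ge> 3" by (auto simp: M_def P_def K_def power_add)
  have P: "P \<ge> 2" "P > \<bar>d\<bar>"
  proof -
    have "\<bar>d\<bar> < 2 ^ nat \<bar>d\<bar>" using of_nat_less_two_power[of "nat \<bar>d\<bar>", where 'a = int] by simp
    also have "\<dots> \<le> (2::int) ^ k" by (rule power_increasing) (auto simp: k_def)
    finally show "P > \<bar>d\<bar>" by (simp add: P_def)
    have "(2::int) ^ 1 \<le> 2 ^ k" by (rule power_increasing) (auto simp: k_def)
    then show "P \<ge> 2" by (simp add: P_def)
  qed
  have gt: "g (n0 + P * t) = n0 + P * t + d" for t
    unfolding P_def using toeplitz_power_mono[of g n0 k0 k t, OF k0] by (simp add: k_def d_def)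
  have d: "\<not> P dvd d" using P n0 dvd_imp_le_int[of d P] by (auto simp: d_def)
  define \<kappa> where "\<kappa> = periodic_cycle M n0 (n0 + 3 * P) (n0 + 2 * P)"
  define \<kappa>' where "\<kappa>' = periodic_cycle M n0 (n0 + 2 * P) (n0 + 3 * P)"
  define \<tau> where "\<tau> = periodic_cycle M (n0 + 2 * P) (n0 + P) (n0 + 4 * P)"
  define h where "h = periodic_cycle M n0 (n0 + P) (n0 + 2 * P)"
  define A where "A = periodic_cycle M (n0 + d) (n0 + 2 * P + d) (n0 + 3 * P + d)"
  have "\<kappa>' \<in> Gamma X" "\<kappa> \<in> Gamma X" unfolding \<kappa>_def \<kappa>'_def
    using Gamma_periodic_cycle(1,2)[OF M, of n0 "n0 + 2 * P" "n0 + 3 * P" X] P by (auto simp: M_def)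
  have \<tau>: "\<tau> \<in> Gamma X" unfolding \<tau>_def
    using Gamma_periodic_cycle(3)[OF M, of "n0 + P" "n0 + 2 * P" "n0 + 4 * P" X] P by (auto simp: M_def)
  have u: "\<exists>t. u + (n0 + s * P) = n0 + P * t" if "u \<in> residue_class M 0" for u s
  proof -
    obtain r where "u = 8 * P * r" using \<open>u \<in> residue_class M 0\<close> by (auto simp: residue_class_def M_def)
    then have "u + (n0 + s * P) = n0 + P * (8 * r + s)" by (simp add: algebra_simps)
    then show ?thesis by blast
  qed
  have gM: "g (u + (n0 + s * P)) = u + (n0 + s * P + d)" if "u \<in> residue_class M 0" for u s
    using u[OF that, of s] gt by (metis add.assoc)
  have inj: "inj g" using N_bij g(1) bij_is_inj by blast
  have "g \<circ> \<kappa>' = A \<circ> g" unfolding \<kappa>'_def A_def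
    by (rule cyc3_conj[OF inj]) (use gM[of _ 0] gM[of _ 2] gM[of _ 3] in \<open>auto simp: mult.commute\<close>)
  then have Ag: "A = g \<circ> (\<kappa>' \<circ> inv_into UNIV g)" using conjugate_eq N_bij g(1) by blast
  have \<kappa>: "inv_into UNIV \<kappa>' = \<kappa>"
  proof (rule inv_unique_comp)
    have "spread (residue_class M 0) {n0, n0 + 2 * P, n0 + 3 * P}" by (rule spread_periodic_cycle) (use P in \<open>auto simp: M_def\<close>)
    from cyc3_inverse[OF this] show "\<kappa>' \<circ> \<kappa> = id" using P by (simp add: \<kappa>_def \<kappa>'_def)
    have "spread (residue_class M 0) {n0, n0 + 3 * P, n0 + 2 * P}"
      using \<open>spread (residue_class M 0) {n0, n0 + 2 * P, n0 + 3 * P}\<close> by (simp add: insert_commute)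
    from cyc3_inverse[OF this] show "\<kappa> \<circ> \<kappa>' = id" using P by (simp add: \<kappa>_def \<kappa>'_def)
  qed
  \<comment> \<open>\<open>A\<close> is the conjugate of \<open>\<kappa>'\<close> by \<open>g\<close>, so \<open>A \<circ> \<kappa>\<close> is the commutator of \<open>g\<close> and \<open>\<kappa>'\<close>.\<close>
  have A\<kappa>: "A \<circ> \<kappa> \<in> N"
  proof -
    have "A \<circ> \<kappa> = g \<circ> (\<kappa>' \<circ> (inv_into UNIV g \<circ> inv_into UNIV \<kappa>'))" by (simp add: Ag \<kappa> o_assoc)
    then show ?thesis using N_comp N_conjugate[OF \<open>\<kappa>' \<in> Gamma X\<close> N_inv[OF g(1)]] g(1) by simp
  qed
  then have "inj A" using N_bij \<open>\<kappa> \<in> Gamma X\<close> Gamma_bij \<kappa> Ag g(1) \<open>\<kappa>' \<in> Gamma X\<close>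
    by (metis bij_comp bij_imp_bij_inv bij_is_inj)
  \<comment> \<open>\<open>A\<close> lives on the class of \<open>n0 + d\<close> modulo \<open>P\<close>, which is disjoint from the class of \<open>n0\<close>.\<close>
  have fixed: "A (u + (n0 + s * P)) = u + (n0 + s * P)" if "u \<in> residue_class M 0" for u s
  proof -
    have "u + (n0 + s * P) - (n0 + r * P + d) \<notin> residue_class M 0" for r
    proof
      assume "u + (n0 + s * P) - (n0 + r * P + d) \<in> residue_class M 0"
      then have "P dvd u" "P dvd u + (n0 + s * P) - (n0 + r * P + d)"
        using that unfolding residue_class_def M_def by (auto dest: dvd_mult_right)
      moreover have "d = u + (s - r) * P - (u + (n0 + s * P) - (n0 + r * P + d))" by (simp add: algebra_simps)
      moreover have "P dvd u + (s - r) * P" using calculation(1) by (rule dvd_add) simp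
      ultimately show False using d dvd_diff by metis
    qed
    from this[of 0] this[of 2] this[of 3] show ?thesis unfolding A_def by (intro cyc3_off) (auto simp: mult.commute)
  qed
  have comm: "A \<circ> periodic_cycle M (n0 + s * P) (n0 + r * P) (n0 + q * P) = periodic_cycle M (n0 + s * P) (n0 + r * P) (n0 + q * P) \<circ> A" for s r q
    by (rule cyc3_conj[OF \<open>inj A\<close>]) (simp add: fixed)
  have Ah: "A \<circ> h = h \<circ> A" using comm[of 0 1 2] by (simp add: h_def)
  have A\<tau>: "A \<circ> \<tau> = \<tau> \<circ> A" using comm[of 2 1 4] by (simp add: \<tau>_def)
  have "spread (residue_class M 0 \<union> residue_class M 0) {n0, n0 + 3 * P, n0 + 2 * P, n0 + P, n0 + 4 * P}"
    by simp (rule spread_residue_class_interval[of _ n0], use P in \<open>auto simp: M_def\<close>)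
  from cyc3_commutator[OF this] have "\<kappa> \<circ> \<tau> = h \<circ> (\<tau> \<circ> \<kappa>)"
    using P by (simp add: \<kappa>_def \<tau>_def h_def)
  then have "(A \<circ> \<kappa>) \<circ> \<tau> = A \<circ> (h \<circ> (\<tau> \<circ> \<kappa>))" by (simp add: comp_assoc)
  also have "\<dots> = h \<circ> (\<tau> \<circ> (A \<circ> \<kappa>))" using Ah A\<tau> by (metis o_assoc)
  finally have "h \<in> N" using N_commutator'[OF A\<kappa> \<tau>] by blast
  moreover have "conjugate_in X (tricycle (residue_class M n0)) h" unfolding h_def
    by (rule conjugate_in_spread[OF M]) (use P in \<open>auto simp: M_def\<close>)
  ultimately have "tricycle (residue_class M n0) \<in> N" using N_conjugate_in by blast
  then show ?thesis using M by blast
qed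

lemma N_tricycle_shift:
  assumes K: "K \<ge> 3" and U: "U \<subseteq> residue_class (2 ^ K) a"
  shows "tricycle (shift 1 U) \<in> N \<longleftrightarrow> tricycle U \<in> N"
proof -
  let ?M = "2 ^ K"
  have M: "?M \<ge> (8::int)" using power_increasing[OF K, of "2::int"] by simp
  let ?\<sigma> = "tricycle (residue_class ?M a) \<circ> tricycle (residue_class ?M (a + 2))"
  have "?\<sigma> \<in> Gamma X" using Gamma_comp Gamma_tricycle_residue_class[OF K] by blast
  with tricycle_translate[OF U M] show ?thesis using N_conj N_conj' by blast
qed

lemma N_tricycle_residue_class_all:
  assumes K: "K \<ge> 3" and "tricycle (residue_class (2 ^ K) a) \<in> N"
  shows "tricycle (residue_class (2 ^ K) (a + t)) \<in> N"
proof (induction t rule: int_induct[of _ 0])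
  case base
  then show ?case using assms by simp
next
  case (step1 i)
  then show ?case using N_tricycle_shift[OF K subset_refl, of "a + i"] by (simp add: shift_residue_class add.assoc)
next
  case (step2 i)
  then show ?case using N_tricycle_shift[OF K subset_refl, of "a + (i - 1)"] by (simp add: shift_residue_class)
qed

text \<open>
  The commutator of the 3-cycle on \<open>V\<close> with a translate of the 3-cycle on the whole residue class is a
  3-cycle on \<open>V\<close> again, and it lies in the normal subgroup because one of its two entries does.
\<close>

lemma N_tricycle_local:
  assumes K: "K \<ge> 3" and N: "\<And>b. tricycle (residue_class (2 ^ K) b) \<in> N"
    and V: "V \<subseteq> residue_class (2 ^ K) c" "tricycle V \<in> Gamma X"
  shows "tricycle V \<in> N"
proof -
  let ?M = "2 ^ K"
  have M: "?M \<ge> (8::int)" using power_increasing[OF K, of "2::int"] by simp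
  have "tricycle V \<circ> tricycle (residue_class ?M (c + 2)) = cyc3 V 0 3 2 \<circ> (tricycle (residue_class ?M (c + 2)) \<circ> tricycle V)"
    using tricycle_commutator[OF V(1) subset_refl M] V(1) by (simp add: shift_residue_class Int_absorb2)
  then have "cyc3 V 0 3 2 \<in> N" by (rule N_commutator[OF V(2) N])
  from N_comp[OF this this] have "cyc3 V 0 2 3 \<in> N" using cyc3_032_squared[OF V(1) M] by simp
  from N_conj[OF _ this tricycle_restore[OF V(1) M]] have "tricycle (shift 1 V) \<in> N" using N N_sub by blast
  then show ?thesis using N_tricycle_shift[OF K V(1)] by simp
qed

text \<open>
  The set is cut into its intersections with residue classes modulo \<open>2 ^ K\<close>, to which
  \<open>N_tricycle_local\<close> applies; the pieces are reassembled by halving the modulus down to 8.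
\<close>

lemma N_tricycle_definable:
  assumes K: "K \<ge> 3" and N: "\<And>b. tricycle (residue_class (2 ^ K) b) \<in> N" and U: "definable a U"
  shows "tricycle (U X) \<in> N"
proof -
  have U8: "U X \<subseteq> residue_class 8 a" using U by (auto simp: definable_def)
  have dec: "tricycle (U X \<inter> residue_class (2 ^ k) c) \<in> N" if "k \<le> K" "k \<ge> 3" "c \<in> residue_class 8 a" for k c
    using that
  proof (induction k arbitrary: c rule: inc_induct)
    case base
    have "8 dvd c - a" using base by (simp add: residue_class_def)
    then have "8 dvd n - c \<longleftrightarrow> 8 dvd n - a" for n by presburger
    then have "residue_class 8 c = residue_class 8 a" by (simp add: residue_class_def)
    then have "definable a (\<lambda>X. residue_class (2 ^ K) c)" using definable_residue_class_power[OF K, of c] by (simp add: definable_def)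
    from Gamma_definable[OF definable_Int[OF U this], of X] show ?case by (intro N_tricycle_local[OF K N]) auto
  next
    case (step k)
    let ?A = "U X \<inter> residue_class (2 ^ Suc k) c" and ?B = "U X \<inter> residue_class (2 ^ Suc k) (c + 2 ^ k)"
    have 8: "(8::int) dvd 2 ^ k" using le_imp_power_dvd[of 3 k "2::int"] step by simp
    have c': "c + 2 ^ k \<in> residue_class 8 a" using step 8 unfolding residue_class_def
      by (metis (no_types, lifting) add_diff_eq diff_add_eq dvd_add mem_Collect_eq)
    have odd_even: "n \<in> residue_class (2 ^ k) c \<longleftrightarrow> n \<in> residue_class (2 ^ Suc k) c \<or> n \<in> residue_class (2 ^ Suc k) (c + 2 ^ k)"
        "\<not> (n \<in> residue_class (2 ^ Suc k) c \<and> n \<in> residue_class (2 ^ Suc k) (c + 2 ^ k))" for n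
    proof -
      have p: "(2::int) ^ k \<noteq> 0" by simp
      have s: "n \<in> residue_class (2 ^ Suc k) c \<longleftrightarrow> (\<exists>q. n - c = 2 ^ k * (2 * q))"
        unfolding residue_class_def dvd_def by (simp add: mult_ac)
      have t: "n \<in> residue_class (2 ^ Suc k) (c + 2 ^ k) \<longleftrightarrow> (\<exists>q. n - c = 2 ^ k * (2 * q + 1))"
        unfolding residue_class_def dvd_def by (simp add: algebra_simps)
      have r: "n \<in> residue_class (2 ^ k) c \<longleftrightarrow> (\<exists>q. n - c = 2 ^ k * q)" unfolding residue_class_def dvd_def by simp
      show "n \<in> residue_class (2 ^ k) c \<longleftrightarrow> n \<in> residue_class (2 ^ Suc k) c \<or> n \<in> residue_class (2 ^ Suc k) (c + 2 ^ k)"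
        unfolding r s t by (metis evenE oddE)
      show "\<not> (n \<in> residue_class (2 ^ Suc k) c \<and> n \<in> residue_class (2 ^ Suc k) (c + 2 ^ k))"
        unfolding s t using p by (metis mult_left_cancel even_add even_mult_iff even_numeral odd_one)
    qed
    have "?A \<union> ?B = U X \<inter> residue_class (2 ^ k) c" "?A \<inter> ?B = {}" using odd_even by blast+
    moreover have "tricycle ?A \<circ> tricycle ?B = tricycle (?A \<union> ?B)"
      by (rule tricycle_union[of _ 8 a]) (use U8 \<open>?A \<inter> ?B = {}\<close> in auto)
    moreover have "tricycle ?A \<in> N" "tricycle ?B \<in> N" using step c' by auto
    ultimately show ?case using N_comp by metis
  qed
  have "a \<in> residue_class 8 a" by (simp add: residue_class_def)
  from dec[OF K order_refl this] show ?thesis using U8 by (simp add: Int_absorb2)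
qed

theorem N_trivial_or_full: "N = {id} \<or> N = Gamma X"
proof (cases "\<exists>g \<in> N. g \<noteq> id")
  case True
  then obtain K a where K: "K \<ge> 3" "tricycle (residue_class (2 ^ K) a) \<in> N" using N_tricycle_seed by blast
  have N: "tricycle (residue_class (2 ^ K) b) \<in> N" for b using N_tricycle_residue_class_all[OF K, of "b - a"] by simp
  have generator: "generator X i \<in> N" for i
    using N_tricycle_definable[OF K(1) N definable_residue_class] N_tricycle_definable[OF K(1) N definable_marked] by (simp add: generator_def)
  have "eval_word X w \<in> N" for w
  proof (induction w)
    case Nil
    then show ?case using N_id by (simp only: eval_word.simps)
  next
    case (Cons i w)
    then show ?case using N_comp[OF generator] by (simp only: eval_word.simps)
  qed
  then show ?thesis using N_sub unfolding Gamma_def by blast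
qed (use N_id in blast)

end

text \<open>
  The 3-cycles based on the multiples of \<open>2 ^ k\<close> are distinct for different \<open>k\<close>.
\<close>

lemma infinite_Gamma: "infinite (Gamma X)"
proof -
  have 8: "residue_class (2 ^ (k + 3)) 0 \<subseteq> residue_class 8 0" for k :: nat
    by (rule residue_class_mono) (simp add: power_add)
  have tricycle_eq: "n \<in> U \<longleftrightarrow> tricycle U n = n + 1" if "U \<subseteq> residue_class 8 0" "n \<in> residue_class 8 0" for U n
  proof -
    have "8 dvd n" using that by (simp add: residue_class_def)
    then have "\<not> 8 dvd n - 1" "\<not> 8 dvd n - 2" by presburger+
    then have "n - 1 \<notin> residue_class 8 0" "n - 2 \<notin> residue_class 8 0" by (simp_all add: residue_class_def)
    then have "n - 1 \<notin> U" "n - 2 \<notin> U" using that by blast+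
    then show ?thesis by (simp add: tricycle_def cyc3_def)
  qed
  have le: "l \<le> k" if "tricycle (residue_class (2 ^ (k + 3)) 0) = tricycle (residue_class (2 ^ (l + 3)) 0)" for k l :: nat
  proof -
    have "2 ^ (k + 3) \<in> residue_class (2 ^ (k + 3)) 0" by (simp add: residue_class_def)
    then have "2 ^ (k + 3) \<in> residue_class (2 ^ (l + 3)) 0"
      using tricycle_eq[OF 8[of k]] tricycle_eq[OF 8[of l]] 8[of k] that by auto
    then have "(2::int) ^ (l + 3) dvd 2 ^ (k + 3)" by (simp add: residue_class_def)
    then show ?thesis using dvd_imp_le_int[of "2 ^ (k + 3)" "2 ^ (l + 3)"] power_le_imp_le_exp[of "2::int" "l + 3" "k + 3"] by simp
  qed
  have "inj (\<lambda>k. tricycle (residue_class (2 ^ (k + 3)) 0))"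
    by (rule injI) (metis le order_antisym)
  moreover have "range (\<lambda>k. tricycle (residue_class (2 ^ (k + 3)) 0)) \<subseteq> Gamma X" using Gamma_tricycle_residue_class by auto
  ultimately show ?thesis using finite_subset range_inj_infinite by blast
qed

section \<open>Invariant means from almost invariant measures on an action\<close>

definition finitely_additive_probability :: "'a set \<Rightarrow> ('a set \<Rightarrow> real) \<Rightarrow> bool" where
  "finitely_additive_probability C \<mu> \<longleftrightarrow> (\<forall>A. A \<subseteq> C \<longrightarrow> 0 \<le> \<mu> A) \<and> \<mu> C = 1 \<and>
     (\<forall>A B. A \<subseteq> C \<longrightarrow> B \<subseteq> C \<longrightarrow> A \<inter> B = {} \<longrightarrow> \<mu> (A \<union> B) = \<mu> A + \<mu> B)"

lemma finitely_additive_probability_le_1: "finitely_additive_probability C \<mu> \<Longrightarrow> A \<subseteq> C \<Longrightarrow> \<mu> A \<le> 1"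
proof -
  assume \<mu>: "finitely_additive_probability C \<mu>" and A: "A \<subseteq> C"
  have "A \<inter> (C - A) = {}" "C - A \<subseteq> C" by auto
  with \<mu> A have "\<mu> (A \<union> (C - A)) = \<mu> A + \<mu> (C - A)" "0 \<le> \<mu> (C - A)"
    by (simp_all only: finitely_additive_probability_def)
  moreover have "A \<union> (C - A) = C" using A by blast
  moreover have "\<mu> C = 1" using \<mu> by (simp add: finitely_additive_probability_def)
  ultimately show ?thesis by simp
qed

text \<open>
  The set functions with values in the unit interval form a compact space in the topology of pointwise
  convergence. The approximately invariant means for given finitely many elements and a given error
  form a closed set, and finitely many of these sets have a common member. A member of all
  of them is invariant.
\<close>

lemma amenable_if_approximate_means:
  fixes G :: "('a, 'b) monoid_scheme"
  assumes G: "group G"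
    and approx: "\<And>F \<epsilon>. finite F \<Longrightarrow> F \<subseteq> carrier G \<Longrightarrow> \<epsilon> > 0 \<Longrightarrow>
      \<exists>\<mu>. finitely_additive_probability (carrier G) \<mu> \<and> (\<forall>g \<in> F. \<forall>A \<subseteq> carrier G. \<bar>\<mu> (g <#\<^bsub>G\<^esub> A) - \<mu> A\<bar> \<le> \<epsilon>)"
  shows "amenable_group G"
proof -
  interpret group G by (rule G)
  let ?C = "carrier G"
  define Z :: "'a set \<Rightarrow> nat \<Rightarrow> ('a set \<Rightarrow> real) set" where
    "Z F n = {\<mu>. finitely_additive_probability ?C \<mu> \<and> (\<forall>g A. g \<in> F \<longrightarrow> A \<subseteq> ?C \<longrightarrow> \<bar>\<mu> (g <#\<^bsub>G\<^esub> A) - \<mu> A\<bar> \<le> 1 / Suc n)}" for F n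
  define K :: "('a set \<Rightarrow> real) set" where "K = PiE UNIV (\<lambda>_. {0..1})"
  have "compactin (product_topology (\<lambda>_. euclidean) UNIV) K"
    unfolding K_def compactin_PiE by simp
  then have K: "compact K" by (simp add: euclidean_product_topology)
  have co: "continuous_on UNIV (\<lambda>\<mu> :: 'a set \<Rightarrow> real. \<mu> A)" for A by (rule continuous_on_product_coordinates)
  have closed: "closed (Z F n)" for F n
    unfolding Z_def finitely_additive_probability_def
    by (intro closed_Collect_conj closed_Collect_all closed_Collect_imp closed_Collect_le closed_Collect_eq
        open_Collect_const continuous_intros co)
  have mono: "Z F n \<subseteq> Z F' n'" if "F' \<subseteq> F" "n' \<le> n" for F F' n n'
  proof
    fix \<mu> assume \<mu>: "\<mu> \<in> Z F n"
    have "1 / real (Suc n) \<le> 1 / real (Suc n')" using that by (simp add: frac_le)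
    then show "\<mu> \<in> Z F' n'" using \<mu> that unfolding Z_def by (auto intro: order_trans)
  qed
  have nonempty: "K \<inter> Z F n \<noteq> {}" if F: "finite F" "F \<subseteq> ?C" for F n
  proof -
    obtain \<mu> where \<mu>: "finitely_additive_probability ?C \<mu>" "\<forall>g \<in> F. \<forall>A \<subseteq> ?C. \<bar>\<mu> (g <#\<^bsub>G\<^esub> A) - \<mu> A\<bar> \<le> 1 / Suc n"
      using approx[OF F, of "1 / Suc n"] by auto
    \<comment> \<open>The space \<open>K\<close> consists of functions on all sets, also on those outside of the carrier.\<close>
    define \<nu> where "\<nu> A = \<mu> (A \<inter> ?C)" for A
    have \<nu>: "\<nu> A = \<mu> A" if "A \<subseteq> ?C" for A using that by (simp add: \<nu>_def Int_absorb2)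
    have "finitely_additive_probability ?C \<nu>" using \<mu>(1) unfolding finitely_additive_probability_def by (simp add: \<nu>)
    moreover have "g <#\<^bsub>G\<^esub> A \<subseteq> ?C" if "g \<in> F" "A \<subseteq> ?C" for g A
      using l_coset_subset_G[of A g] that F by blast
    ultimately have "\<nu> \<in> Z F n" using \<mu>(2) by (simp add: Z_def \<nu>)
    moreover have "\<nu> A \<in> {0..1}" for A
      using \<mu>(1) finitely_additive_probability_le_1[OF \<mu>(1), of "A \<inter> ?C"] by (auto simp: \<nu>_def finitely_additive_probability_def)
    then have "\<nu> \<in> K" by (auto simp: K_def)
    ultimately show ?thesis by blast
  qed
  let ?I = "{(F, n :: nat). finite F \<and> F \<subseteq> ?C}"
  have "K \<inter> (\<Inter>i \<in> ?I. Z (fst i) (snd i)) \<noteq> {}"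
  proof (rule compact_imp_fip_image[OF K])
    fix I' assume I': "finite I'" "I' \<subseteq> ?I"
    let ?F = "\<Union>(fst ` I')" and ?n = "Max (insert 0 (snd ` I'))"
    have "finite (fst i)" "fst i \<subseteq> ?C" if "i \<in> I'" for i
      using subsetD[OF I'(2) that] by (cases i; simp)+
    then have "finite ?F" "?F \<subseteq> ?C" using I'(1) by (blast intro: finite_UN_I)+
    then have "K \<inter> Z ?F ?n \<noteq> {}" by (rule nonempty)
    moreover have "Z ?F ?n \<subseteq> Z (fst i) (snd i)" if "i \<in> I'" for i
      by (rule mono) (use that I' in auto)
    ultimately show "K \<inter> (\<Inter>i \<in> I'. Z (fst i) (snd i)) \<noteq> {}" by blast
  qed (use closed in auto)
  then obtain \<mu> where \<mu>: "\<mu> \<in> Z F n" if "finite F" "F \<subseteq> ?C" for F n by fastforce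
  have "\<mu> (g <#\<^bsub>G\<^esub> A) = \<mu> A" if "g \<in> ?C" "A \<subseteq> ?C" for g A
  proof (rule ccontr)
    assume "\<mu> (g <#\<^bsub>G\<^esub> A) \<noteq> \<mu> A"
    then obtain n where n: "inverse (real (Suc n)) < \<bar>\<mu> (g <#\<^bsub>G\<^esub> A) - \<mu> A\<bar>"
      using reals_Archimedean[of "\<bar>\<mu> (g <#\<^bsub>G\<^esub> A) - \<mu> A\<bar>"] by auto
    moreover have "\<mu> \<in> Z {g} n" by (rule \<mu>) (use that in auto)
    ultimately show False using that by (auto simp: Z_def inverse_eq_divide)
  qed
  moreover have "finitely_additive_probability ?C \<mu>" using \<mu>[of "{}" 0] by (simp add: Z_def)
  ultimately have "left_invariant_mean G \<mu>" by (simp add: left_invariant_mean_def finitely_additive_probability_def)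
  with G show ?thesis unfolding amenable_group_def by blast
qed

lemma card_Un_Int_coset: "finite T \<Longrightarrow> A \<inter> B = {} \<Longrightarrow> card ((A \<union> B) \<inter> T) = card (A \<inter> T) + card (B \<inter> T)"
  by (subst card_Un_disjoint[symmetric]) (auto simp: Int_Un_distrib2)

locale group_acting = group G for G :: "('g, 'b) monoid_scheme" (structure) +
  fixes act :: "'g \<Rightarrow> 'x \<Rightarrow> 'x" and X :: "'x set"
  assumes act_closed: "\<And>g x. g \<in> carrier G \<Longrightarrow> x \<in> X \<Longrightarrow> act g x \<in> X"
    and act_one: "\<And>x. x \<in> X \<Longrightarrow> act \<one> x = x"
    and act_mult: "\<And>g h x. g \<in> carrier G \<Longrightarrow> h \<in> carrier G \<Longrightarrow> x \<in> X \<Longrightarrow> act (g \<otimes> h) x = act g (act h x)"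
begin

lemma act_inv: "g \<in> carrier G \<Longrightarrow> x \<in> X \<Longrightarrow> act (inv g) (act g x) = x"
  using act_mult[of "inv g" g x] act_one by simp

lemma act_inv': "g \<in> carrier G \<Longrightarrow> x \<in> X \<Longrightarrow> act g (act (inv g) x) = x"
  using act_mult[of g "inv g" x] act_one by simp

text \<open>
  The next definitions choose a representative of every orbit and, for every point, an element
  that transports the representative of its orbit to it. The cocycle compares the two ways from
  the representative to \<open>act g x\<close>; it lies in the stabilizer of the representative.
\<close>

definition act_orbit :: "'x \<Rightarrow> 'x set" where
  "act_orbit x = {act g x |g. g \<in> carrier G}"

lemma act_orbit_act: assumes "g \<in> carrier G" "x \<in> X" shows "act_orbit (act g x) = act_orbit x"
proof
  show "act_orbit (act g x) \<subseteq> act_orbit x" unfolding act_orbit_def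
    using assms by (auto simp: act_mult[symmetric])
  show "act_orbit x \<subseteq> act_orbit (act g x)"
  proof
    fix y assume "y \<in> act_orbit x"
    then obtain h where h: "h \<in> carrier G" "y = act h x" unfolding act_orbit_def by blast
    then have "act (h \<otimes> inv g) (act g x) = act h (act (inv g) (act g x))"
      using assms by (intro act_mult act_closed) auto
    then have "y = act (h \<otimes> inv g) (act g x)" using h assms by (simp add: act_inv)
    then show "y \<in> act_orbit (act g x)" unfolding act_orbit_def using h assms by blast
  qed
qed

definition orb_rep :: "'x \<Rightarrow> 'x" where
  "orb_rep x = (SOME y. y \<in> act_orbit x)"

lemma orb_rep: assumes "x \<in> X" shows "orb_rep x \<in> X" "\<exists>g \<in> carrier G. act g (orb_rep x) = x"
proof -
  have "x \<in> act_orbit x" unfolding act_orbit_def using assms act_one by force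
  then have "orb_rep x \<in> act_orbit x" unfolding orb_rep_def by (rule someI)
  then obtain g where g: "g \<in> carrier G" "orb_rep x = act g x" unfolding act_orbit_def by blast
  then show "orb_rep x \<in> X" using assms act_closed by simp
  have "act (inv g) (orb_rep x) = x" using g assms act_inv by simp
  then show "\<exists>g \<in> carrier G. act g (orb_rep x) = x" using g by blast
qed

lemma orb_rep_act: "g \<in> carrier G \<Longrightarrow> x \<in> X \<Longrightarrow> orb_rep (act g x) = orb_rep x"
  by (simp add: orb_rep_def act_orbit_act)

definition transport :: "'x \<Rightarrow> 'g" where
  "transport x = (SOME g. g \<in> carrier G \<and> act g (orb_rep x) = x)"

lemma transport: assumes "x \<in> X" shows "transport x \<in> carrier G" "act (transport x) (orb_rep x) = x"
proof -
  have "\<exists>g. g \<in> carrier G \<and> act g (orb_rep x) = x" using orb_rep(2)[OF assms] by blast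
  from someI_ex[OF this] show "transport x \<in> carrier G" "act (transport x) (orb_rep x) = x"
    unfolding transport_def by blast+
qed

definition cocycle :: "'g \<Rightarrow> 'x \<Rightarrow> 'g" where
  "cocycle g x = inv (transport (act g x)) \<otimes> (g \<otimes> transport x)"

lemma cocycle:
  assumes g: "g \<in> carrier G" and x: "x \<in> X"
  shows "cocycle g x \<in> carrier G" "act (cocycle g x) (orb_rep x) = orb_rep x"
    "g \<otimes> transport x = transport (act g x) \<otimes> cocycle g x"
proof -
  note t = transport[OF x] transport[OF act_closed[OF g x]]
  show "cocycle g x \<in> carrier G" unfolding cocycle_def using g t by simp
  have "act (cocycle g x) (orb_rep x) = act (inv (transport (act g x))) (act g (act (transport x) (orb_rep x)))"
    unfolding cocycle_def using g t orb_rep(1)[OF x] by (simp add: act_mult act_closed)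
  also have "\<dots> = act (inv (transport (act g x))) (act (transport (act g x)) (orb_rep (act g x)))"
    using t by simp
  also have "\<dots> = orb_rep x"
    using act_inv[OF t(3), of "orb_rep (act g x)"] orb_rep(1)[OF x] orb_rep_act[OF g x] by simp
  finally show "act (cocycle g x) (orb_rep x) = orb_rep x" .
  show "g \<otimes> transport x = transport (act g x) \<otimes> cocycle g x"
    unfolding cocycle_def using g t by (simp add: m_assoc[symmetric])
qed

text \<open>
  The mass at a point \<open>x\<close> is spread uniformly over the coset \<open>transport x <# H\<close>, where \<open>H\<close> is a finite
  subgroup that contains the finitely many values of the cocycle that occur. An element \<open>g\<close> then
  maps the coset of \<open>x\<close> onto the coset of \<open>act g x\<close>, so the resulting measure on the group is as
  invariant as the measure on the space.
\<close>

theorem amenable_if_almost_invariant: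
  assumes locally_finite: "\<And>x T. x \<in> X \<Longrightarrow> finite T \<Longrightarrow> T \<subseteq> carrier G \<Longrightarrow> (\<And>g. g \<in> T \<Longrightarrow> act g x = x) \<Longrightarrow>
      \<exists>H. finite H \<and> subgroup H G \<and> T \<subseteq> H"
    and almost_invariant: "\<And>F \<epsilon>. finite F \<Longrightarrow> F \<subseteq> carrier G \<Longrightarrow> (\<epsilon>::real) > 0 \<Longrightarrow>
      \<exists>p Y. finite Y \<and> Y \<subseteq> X \<and> (\<forall>x. 0 \<le> p x) \<and> (\<forall>x. x \<notin> Y \<longrightarrow> p x = 0) \<and> sum p Y = 1 \<and>
        (\<forall>g \<in> F. \<forall>Z \<subseteq> X. finite Z \<longrightarrow> (\<Sum>x\<in>Z. \<bar>p (act g x) - p x\<bar>) \<le> \<epsilon>)"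
  shows "amenable_group G"
proof (rule amenable_if_approximate_means[OF is_group])
  fix F and \<epsilon> :: real
  assume F: "finite F" "F \<subseteq> carrier G" and "\<epsilon> > 0"
  from almost_invariant[OF this] obtain p Y where *: "finite Y \<and> Y \<subseteq> X \<and> (\<forall>x. 0 \<le> p x) \<and>
      (\<forall>x. x \<notin> Y \<longrightarrow> p x = 0) \<and> sum p Y = 1 \<and>
      (\<forall>g \<in> F. \<forall>Z \<subseteq> X. finite Z \<longrightarrow> (\<Sum>x\<in>Z. \<bar>p (act g x) - p x\<bar>) \<le> \<epsilon>)"
    by (elim exE)
  then have Y: "finite Y" "Y \<subseteq> X"
    and p: "\<And>x. 0 \<le> p x" "\<And>x. x \<notin> Y \<Longrightarrow> p x = 0" "sum p Y = 1"
    and inv: "\<And>g Z. g \<in> F \<Longrightarrow> Z \<subseteq> X \<Longrightarrow> finite Z \<Longrightarrow> (\<Sum>x\<in>Z. \<bar>p (act g x) - p x\<bar>) \<le> \<epsilon>"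
    by simp_all
  define T where "T y = (\<lambda>(g, x). cocycle (inv g) x) ` {(g, x) \<in> F \<times> Y. orb_rep x = y}" for y
  have "\<exists>H. finite H \<and> subgroup H G \<and> T y \<subseteq> H" if "y \<in> X" for y
  proof (rule locally_finite[OF that])
    show "finite (T y)" unfolding T_def using F Y by (auto intro: finite_subset[of _ "F \<times> Y"])
    have gx: "inv g \<in> carrier G" "x \<in> X" if "g \<in> F" "x \<in> Y" for g x using that F Y by auto
    show "T y \<subseteq> carrier G" unfolding T_def using cocycle(1)[OF gx] by auto
    show "act g y = y" if "g \<in> T y" for g
      using that cocycle(2)[OF gx] unfolding T_def by auto
  qed
  then obtain H where H: "\<And>y. y \<in> X \<Longrightarrow> finite (H y) \<and> subgroup (H y) G \<and> T y \<subseteq> H y" by metis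
  define m where "m x B = real (card (B \<inter> (transport x <# H (orb_rep x)))) / card (H (orb_rep x))" for x B
  define \<mu> where "\<mu> B = (\<Sum>x\<in>Y. p x * m x B)" for B
  have coset: "finite (transport x <# H (orb_rep x))" "card (transport x <# H (orb_rep x)) = card (H (orb_rep x))"
    "card (H (orb_rep x)) > 0" "transport x <# H (orb_rep x) \<subseteq> carrier G" if "x \<in> X" for x
  proof -
    have Hx: "finite (H (orb_rep x))" "subgroup (H (orb_rep x)) G" using H orb_rep(1)[OF that] by auto
    have eq: "transport x <# H (orb_rep x) = (\<lambda>h. transport x \<otimes> h) ` H (orb_rep x)"
      by (auto simp: l_coset_def)
    have "inj_on (\<lambda>h. transport x \<otimes> h) (H (orb_rep x))"
      using subgroup.mem_carrier[OF Hx(2)] transport(1)[OF that] by (intro inj_onI) simp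
    then show "finite (transport x <# H (orb_rep x))"
      "card (transport x <# H (orb_rep x)) = card (H (orb_rep x))"
      using Hx unfolding eq by (auto simp: card_image)
    show "card (H (orb_rep x)) > 0" using Hx subgroup.one_closed card_gt_0_iff by fastforce
    show "transport x <# H (orb_rep x) \<subseteq> carrier G"
      using l_coset_subset_G[OF subgroup.subset[OF Hx(2)] transport(1)[OF that]] .
  qed
  have m: "0 \<le> m x B" "m x B \<le> 1" if "x \<in> X" for x B
  proof -
    show "0 \<le> m x B" by (simp add: m_def)
    have "card (B \<inter> (transport x <# H (orb_rep x))) \<le> card (H (orb_rep x))"
      using card_mono[OF coset(1)[OF that], of "B \<inter> (transport x <# H (orb_rep x))"] coset(2)[OF that] by simp
    then show "m x B \<le> 1" using coset(3)[OF that] by (simp add: m_def)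
  qed
  have "finitely_additive_probability (carrier G) \<mu>"
    unfolding finitely_additive_probability_def
  proof (intro conjI allI impI)
    fix A show "0 \<le> \<mu> A" unfolding \<mu>_def using Y p m by (intro sum_nonneg mult_nonneg_nonneg) auto
  next
    have "m x (carrier G) = 1" if "x \<in> Y" for x
      using coset[of x] that Y by (auto simp: m_def Int_absorb1)
    then show "\<mu> (carrier G) = 1" using p(3) by (simp add: \<mu>_def)
  next
    fix A B assume "A \<inter> B = ({} :: 'g set)"
    then have "m x (A \<union> B) = m x A + m x B" if "x \<in> Y" for x
      using coset(1)[of x] that Y by (auto simp: m_def card_Un_Int_coset add_divide_distrib)
    then show "\<mu> (A \<union> B) = \<mu> A + \<mu> B"
      by (simp add: \<mu>_def distrib_left sum.distrib)
  qed
  moreover have "\<bar>\<mu> (g <# B) - \<mu> B\<bar> \<le> \<epsilon>" if g: "g \<in> F" and B: "B \<subseteq> carrier G" for g B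
  proof -
    have gC: "g \<in> carrier G" "inv g \<in> carrier G" using g F by auto
    \<comment> \<open>Moving \<open>B\<close> by \<open>g\<close> amounts to moving the coset of \<open>x\<close> to the coset of \<open>act (inv g) x\<close>.\<close>
    have shift: "m x (g <# B) = m (act (inv g) x) B" if x: "x \<in> Y" for x
    proof -
      let ?x = "act (inv g) x" and ?y = "orb_rep x"
      have xX: "x \<in> X" "?x \<in> X" using x Y act_closed gC by auto
      have Hy: "subgroup (H ?y) G" "T ?y \<subseteq> H ?y" using H orb_rep(1)[OF xX(1)] by auto
      have c: "cocycle (inv g) x \<in> H ?y" using Hy(2) g x unfolding T_def by auto
      have tx: "transport x \<in> carrier G" "transport ?x \<in> carrier G" using transport xX by auto
      have HG: "H ?y \<subseteq> carrier G" using subgroup.subset Hy(1) by blast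
      have "inv g <# (transport x <# H ?y) = (inv g \<otimes> transport x) <# H ?y"
        using lcos_m_assoc[OF HG gC(2) tx(1)] .
      also have "\<dots> = transport ?x <# (cocycle (inv g) x <# H ?y)"
        using lcos_m_assoc[OF HG tx(2) cocycle(1)[OF gC(2) xX(1)]] cocycle(3)[OF gC(2) xX(1)] by simp
      also have "cocycle (inv g) x <# H ?y = H ?y" using coset_join3[OF cocycle(1)[OF gC(2) xX(1)] Hy(1) c] .
      finally have "inv g <# (transport x <# H ?y) = transport ?x <# H ?y" .
      then have e: "transport x <# H ?y = g <# (transport ?x <# H ?y)"
        using lcos_m_assoc[OF coset(4)[OF xX(1)] gC] lcos_mult_one[OF coset(4)[OF xX(1)]] gC by simp
      have r: "orb_rep ?x = ?y" by (rule orb_rep_act[OF gC(2) xX(1)])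
      have SC: "transport ?x <# H ?y \<subseteq> carrier G" using coset(4)[OF xX(2)] by (simp add: r)
      have inj: "inj_on (\<lambda>b. g \<otimes> b) (carrier G)" using gC(1) by (intro inj_onI) simp
      have img: "g <# D = (\<lambda>b. g \<otimes> b) ` D" for D by (auto simp: l_coset_def)
      have "(g <# B) \<inter> (g <# (transport ?x <# H ?y)) = (\<lambda>b. g \<otimes> b) ` (B \<inter> (transport ?x <# H ?y))"
        unfolding img[of B] img[of "transport ?x <# H ?y"] by (rule inj_on_image_Int[OF inj B SC, symmetric])
      moreover have "inj_on (\<lambda>b. g \<otimes> b) (B \<inter> (transport ?x <# H ?y))"
        using inj_on_subset[OF inj] B by blast
      ultimately have "card ((g <# B) \<inter> (transport x <# H ?y)) = card (B \<inter> (transport ?x <# H ?y))"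
        unfolding e by (simp add: card_image)
      then show ?thesis by (simp add: m_def r)
    qed
    define Z where "Z = Y \<union> act (inv g) ` Y"
    have Z: "finite Z" "Z \<subseteq> X" using Y act_closed gC unfolding Z_def by auto
    have "\<mu> (g <# B) = (\<Sum>x\<in>Y. p x * m (act (inv g) x) B)" unfolding \<mu>_def using shift by simp
    also have "\<dots> = (\<Sum>x\<in>act (inv g) ` Y. p (act g x) * m x B)"
    proof (subst sum.reindex)
      show "inj_on (act (inv g)) Y"
        by (rule inj_on_inverseI[where g = "act g"]) (use act_inv'[OF gC(1)] Y in blast)
      show "(\<Sum>x\<in>Y. p x * m (act (inv g) x) B) = (\<Sum>x\<in>Y. ((\<lambda>x. p (act g x) * m x B) \<circ> act (inv g)) x)"
        using act_inv'[OF gC(1)] Y by (intro sum.cong) auto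
    qed
    also have "\<dots> = (\<Sum>x\<in>Z. p (act g x) * m x B)"
    proof (rule sum.mono_neutral_left[OF Z(1)])
      show "\<forall>x \<in> Z - act (inv g) ` Y. p (act g x) * m x B = 0"
      proof
        fix x assume x: "x \<in> Z - act (inv g) ` Y"
        then have "act g x \<notin> Y" using act_inv[OF gC(1), of x] Z by force
        then show "p (act g x) * m x B = 0" using p(2) by simp
      qed
    qed (auto simp: Z_def)
    finally have 1: "\<mu> (g <# B) = (\<Sum>x\<in>Z. p (act g x) * m x B)" .
    have 2: "\<mu> B = (\<Sum>x\<in>Z. p x * m x B)" unfolding \<mu>_def
      by (rule sum.mono_neutral_left[OF Z(1)]) (auto simp: Z_def p(2))
    have "\<bar>\<mu> (g <# B) - \<mu> B\<bar> = \<bar>\<Sum>x\<in>Z. (p (act g x) - p x) * m x B\<bar>"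
      unfolding 1 2 by (simp add: sum_subtractf left_diff_distrib)
    also have "\<dots> \<le> (\<Sum>x\<in>Z. \<bar>(p (act g x) - p x) * m x B\<bar>)" by (rule sum_abs)
    also have "\<dots> \<le> (\<Sum>x\<in>Z. \<bar>p (act g x) - p x\<bar>)"
    proof (rule sum_mono)
      fix x assume "x \<in> Z"
      then have "\<bar>m x B\<bar> \<le> 1" using m[of x B] Z by auto
      then show "\<bar>(p (act g x) - p x) * m x B\<bar> \<le> \<bar>p (act g x) - p x\<bar>"
        by (simp add: abs_mult mult_left_le)
    qed
    also have "\<dots> \<le> \<epsilon>" using inv[OF g Z(2,1)] .
    finally show ?thesis .
  qed
  ultimately show "\<exists>\<mu>. finitely_additive_probability (carrier G) \<mu> \<and> (\<forall>g \<in> F. \<forall>A \<subseteq> carrier G. \<bar>\<mu> (g <# A) - \<mu> A\<bar> \<le> \<epsilon>)" by blast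
qed

end

section \<open>Almost invariant measures on cuts of the integers\<close>

definition is_cut :: "int set \<Rightarrow> bool" where
  "is_cut A \<longleftrightarrow> (\<exists>M. \<forall>n. (n > M \<longrightarrow> n \<in> A) \<and> (n < - M \<longrightarrow> n \<notin> A))"

text \<open>
  The amplitude of a cut is a product over all integers, almost all factors being one. Its square is
  the probability of the cut if each \<open>j\<close> is included independently with probability
  \<open>(sin (\<theta> j))\<^sup>2\<close>.
\<close>

definition factor :: "(int \<Rightarrow> real) \<Rightarrow> int set \<Rightarrow> int \<Rightarrow> real" where
  "factor \<theta> A j = (if j \<in> A then sin (\<theta> j) else cos (\<theta> j))"

definition amplitude :: "(int \<Rightarrow> real) \<Rightarrow> int set \<Rightarrow> real" where
  "amplitude \<theta> A = (\<Prod>j | factor \<theta> A j \<noteq> 1. factor \<theta> A j)"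

definition slope :: "int \<Rightarrow> int \<Rightarrow> (int \<Rightarrow> real) \<Rightarrow> bool" where
  "slope a b \<theta> \<longleftrightarrow> (\<forall>j<a. \<theta> j = 0) \<and> (\<forall>j\<ge>b. \<theta> j = pi / 2)"

lemma slopeD:
  assumes "slope a b \<theta>"
  shows "j < a \<Longrightarrow> sin (\<theta> j) = 0" "j < a \<Longrightarrow> cos (\<theta> j) = 1"
    "j \<ge> b \<Longrightarrow> sin (\<theta> j) = 1" "j \<ge> b \<Longrightarrow> cos (\<theta> j) = 0"
  using assms unfolding slope_def by (simp_all only: sin_zero cos_zero sin_pi_half cos_pi_half)

text \<open>
  The cuts of nonzero amplitude, for angles that are constant outside of the interval.
\<close>

definition step_sets :: "int \<Rightarrow> int \<Rightarrow> int set set" where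
  "step_sets a b = (\<lambda>E. E \<union> {b..}) ` Pow {a..<b}"

lemma finite_step_sets: "finite (step_sets a b)"
  by (simp add: step_sets_def)

lemma is_cut_step_sets: "A \<in> step_sets a b \<Longrightarrow> is_cut A"
  unfolding is_cut_def step_sets_def
  by (rule exI[of _ "\<bar>a\<bar> + \<bar>b\<bar>"]) force

lemma amplitude_step_sets:
  assumes "slope a b \<theta>" "E \<subseteq> {a..<b}" "a \<le> b"
  shows "amplitude \<theta> (E \<union> {b..}) = (\<Prod>j\<in>{a..<b}. if j \<in> E then sin (\<theta> j) else cos (\<theta> j))"
proof -
  let ?A = "E \<union> {b..}"
  have out: "factor \<theta> ?A j = 1" if "j \<notin> {a..<b}" for j
    using that assms(2,3) by (cases "j < a") (auto simp: factor_def slopeD[OF assms(1)])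
  have "amplitude \<theta> ?A = (\<Prod>j\<in>{a..<b}. factor \<theta> ?A j)"
    unfolding amplitude_def
  proof (rule prod.mono_neutral_left)
    show "{j. factor \<theta> ?A j \<noteq> 1} \<subseteq> {a..<b}" using out by blast
  qed auto
  also have "\<dots> = (\<Prod>j\<in>{a..<b}. if j \<in> E then sin (\<theta> j) else cos (\<theta> j))"
    by (rule prod.cong) (auto simp: factor_def)
  finally show ?thesis .
qed

lemma amplitude_outside:
  assumes \<theta>: "slope a b \<theta>" and A: "is_cut A" "A \<notin> step_sets a b"
  shows "amplitude \<theta> A = 0"
proof -
  obtain M where M: "\<And>n. n > M \<Longrightarrow> n \<in> A" "\<And>n. n < - M \<Longrightarrow> n \<notin> A" using A is_cut_def by auto
  have "\<exists>j. factor \<theta> A j = 0"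
  proof (rule ccontr)
    assume nz: "\<nexists>j. factor \<theta> A j = 0"
    have "j \<notin> A" if "j < a" for j using nz slopeD(1)[OF \<theta> that] unfolding factor_def by metis
    moreover have "j \<in> A" if "j \<ge> b" for j using nz slopeD(4)[OF \<theta> that] unfolding factor_def by metis
    ultimately have "A = (A \<inter> {a..<b}) \<union> {b..}" by force
    then show False using A(2) unfolding step_sets_def by blast
  qed
  then obtain j where j: "factor \<theta> A j = 0" by blast
  have "finite {j. factor \<theta> A j \<noteq> 1}"
  proof (rule finite_subset)
    have "factor \<theta> A j = 1" if "j > max M b" for j
      using that slopeD(3)[OF \<theta>, of j] M(1)[of j] by (simp add: factor_def)
    moreover have "factor \<theta> A j = 1" if "j < min (-M) a" for j
      using that slopeD(2)[OF \<theta>, of j] M(2)[of j] by (simp add: factor_def)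
    ultimately show "{j. factor \<theta> A j \<noteq> 1} \<subseteq> {min (-M) a..max M b}"
      by (force simp: not_less[symmetric])
  qed simp
  then show ?thesis unfolding amplitude_def by (rule prod_zero) (auto intro!: exI[of _ j] simp: j)
qed

text \<open>
  The sum over all subsets of a product of factors is the product of the sums of the two factors, and
  these are given by the addition formula for the cosine.
\<close>

lemma amplitude_inner_product:
  assumes "slope a b \<theta>" "slope a b \<phi>" "a \<le> b"
  shows "(\<Sum>A\<in>step_sets a b. amplitude \<theta> A * amplitude \<phi> A) = (\<Prod>j\<in>{a..<b}. cos (\<theta> j - \<phi> j))"
proof -
  let ?J = "{a..<b}"
  have "inj_on (\<lambda>E. E \<union> {b..}) (Pow ?J)"
  proof (rule inj_onI)
    fix E F assume EF: "E \<in> Pow ?J" "F \<in> Pow ?J" "E \<union> {b..} = F \<union> {b..}"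
    then have "E = (E \<union> {b..}) \<inter> ?J" "F = (F \<union> {b..}) \<inter> ?J" by auto
    with EF(3) show "E = F" by simp
  qed
  then have "(\<Sum>A\<in>step_sets a b. amplitude \<theta> A * amplitude \<phi> A) =
      (\<Sum>E\<in>Pow ?J. amplitude \<theta> (E \<union> {b..}) * amplitude \<phi> (E \<union> {b..}))"
    unfolding step_sets_def by (simp add: sum.reindex)
  also have "\<dots> = (\<Sum>E\<in>Pow ?J. (\<Prod>j\<in>E. sin (\<theta> j) * sin (\<phi> j)) * (\<Prod>j\<in>?J - E. cos (\<theta> j) * cos (\<phi> j)))"
  proof (rule sum.cong[OF refl])
    fix E assume E: "E \<in> Pow ?J"
    then have E': "?J \<inter> E = E" "?J \<inter> - E = ?J - E" by auto
    have "amplitude \<theta> (E \<union> {b..}) * amplitude \<phi> (E \<union> {b..}) =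
        (\<Prod>j\<in>?J. if j \<in> E then sin (\<theta> j) * sin (\<phi> j) else cos (\<theta> j) * cos (\<phi> j))"
      using E assms by (simp add: amplitude_step_sets prod.distrib[symmetric] if_distrib cong: if_cong)
    also have "\<dots> = (\<Prod>j\<in>E. sin (\<theta> j) * sin (\<phi> j)) * (\<Prod>j\<in>?J - E. cos (\<theta> j) * cos (\<phi> j))"
      using prod.If_cases[of ?J "\<lambda>j. j \<in> E"] E' by simp
    finally show "amplitude \<theta> (E \<union> {b..}) * amplitude \<phi> (E \<union> {b..}) = \<dots>" .
  qed
  also have "\<dots> = (\<Prod>j\<in>?J. sin (\<theta> j) * sin (\<phi> j) + cos (\<theta> j) * cos (\<phi> j))"
    by (rule prod_add[symmetric]) simp
  also have "\<dots> = (\<Prod>j\<in>?J. cos (\<theta> j - \<phi> j))" by (simp add: cos_diff add.commute)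
  finally show ?thesis .
qed

lemma amplitude_image:
  assumes "bij g" shows "amplitude \<theta> (g ` A) = amplitude (\<theta> \<circ> g) A"
proof -
  have f: "factor \<theta> (g ` A) (g i) = factor (\<theta> \<circ> g) A i" for i
    using assms by (simp add: factor_def inj_image_mem_iff bij_is_inj)
  have "{j. factor \<theta> (g ` A) j \<noteq> 1} = g ` {i. factor (\<theta> \<circ> g) A i \<noteq> 1}"
  proof safe
    fix j assume "factor \<theta> (g ` A) j \<noteq> 1"
    moreover obtain i where "j = g i" using assms by (metis bij_pointE)
    ultimately show "j \<in> g ` {i. factor (\<theta> \<circ> g) A i \<noteq> 1}" using f by auto
  qed (simp add: f)
  then show ?thesis unfolding amplitude_def
    using assms by (simp add: prod.reindex inj_on_subset[OF bij_is_inj] f)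
qed

lemma prod_ge_one_minus_sum:
  fixes f :: "'a \<Rightarrow> real"
  assumes "finite A" "\<And>x. x \<in> A \<Longrightarrow> 0 \<le> f x \<and> f x \<le> 1"
  shows "1 - (\<Sum>x\<in>A. 1 - f x) \<le> prod f A" "0 \<le> prod f A" "prod f A \<le> 1"
proof -
  have "1 - (\<Sum>x\<in>A. 1 - f x) \<le> prod f A \<and> 0 \<le> prod f A \<and> prod f A \<le> 1"
    using assms
  proof (induction A rule: finite_induct)
    case (insert x A)
    then have f: "0 \<le> f x" "f x \<le> 1" and P: "1 - (\<Sum>x\<in>A. 1 - f x) \<le> prod f A" "0 \<le> prod f A" "prod f A \<le> 1" by auto
    have "(1 - f x) * prod f A \<le> (1 - f x) * 1" using f P by (intro mult_left_mono) auto
    then have "prod f A - (1 - f x) \<le> f x * prod f A" by (simp add: algebra_simps)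
    then show ?case using insert.hyps f P by (simp add: mult_le_one)
  qed simp
  then show "1 - (\<Sum>x\<in>A. 1 - f x) \<le> prod f A" "0 \<le> prod f A" "prod f A \<le> 1" by auto
qed

lemma one_minus_cos_le: "1 - cos (x::real) \<le> x\<^sup>2 / 2"
proof -
  have "\<bar>sin (x / 2)\<bar> \<le> \<bar>x / 2\<bar>" by (rule abs_sin_x_le_abs_x)
  then have "(sin (x / 2))\<^sup>2 \<le> (x / 2)\<^sup>2" by (rule abs_le_square_iff[THEN iffD1])
  moreover have "cos x = 1 - 2 * (sin (x / 2))\<^sup>2" using cos_double_sin[of "x / 2"] by simp
  ultimately show ?thesis by (simp add: power_divide)
qed

definition ramp :: "nat \<Rightarrow> int \<Rightarrow> real" where
  "ramp N j = pi / 2 * max 0 (min 1 (real_of_int j / real N))"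

lemma ramp_bounds: "0 \<le> ramp N j" "ramp N j \<le> pi / 2"
  unfolding ramp_def using pi_gt_zero by (auto simp: mult_left_le)

lemma ramp_lipschitz: "N > 0 \<Longrightarrow> \<bar>ramp N i - ramp N j\<bar> \<le> 2 * (\<bar>real_of_int (i - j)\<bar> / N)"
proof -
  assume N: "N > 0"
  have "\<bar>max 0 (min 1 x) - max 0 (min 1 y)\<bar> \<le> \<bar>x - y\<bar>" for x y :: real by linarith
  then have "\<bar>max 0 (min 1 (real_of_int i / N)) - max 0 (min 1 (real_of_int j / N))\<bar> \<le> \<bar>real_of_int i / N - real_of_int j / N\<bar>" .
  also have "\<dots> = \<bar>real_of_int (i - j)\<bar> / N" using N by (simp add: diff_divide_distrib[symmetric])
  finally have 1: "\<bar>max 0 (min 1 (real_of_int i / N)) - max 0 (min 1 (real_of_int j / N))\<bar> \<le> \<bar>real_of_int (i - j)\<bar> / N" .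
  have "\<bar>ramp N i - ramp N j\<bar> = pi / 2 * \<bar>max 0 (min 1 (real_of_int i / N)) - max 0 (min 1 (real_of_int j / N))\<bar>"
    unfolding ramp_def right_diff_distrib[symmetric] abs_mult by simp
  also have "\<dots> \<le> 2 * (\<bar>real_of_int (i - j)\<bar> / N)"
    using 1 pi_less_4 by (intro mult_mono) auto
  finally show ?thesis .
qed

lemma slope_ramp: "N > 0 \<Longrightarrow> slope 0 (int N) (ramp N)"
  unfolding slope_def ramp_def
  by (auto simp: divide_le_0_iff zero_le_divide_iff max_def min_def)

text \<open>
  For unit vectors with inner product \<open>c\<close>, the Cauchy-Schwarz inequality bounds the distance of the two
  probability vectors of squares, because \<open>u\<^sup>2 - v\<^sup>2 = (u - v) * (u + v)\<close>.
\<close>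

lemma sum_diff_squares_le:
  fixes u v :: "'a \<Rightarrow> real"
  assumes "finite A" "(\<Sum>x\<in>A. u x * u x) = 1" "(\<Sum>x\<in>A. v x * v x) = 1"
    and c: "(\<Sum>x\<in>A. u x * v x) = c" "0 \<le> c" "c \<le> 1"
  shows "(\<Sum>x\<in>A. \<bar>(u x)\<^sup>2 - (v x)\<^sup>2\<bar>)\<^sup>2 \<le> 8 * (1 - c)"
proof -
  have "(\<Sum>x\<in>A. \<bar>(u x)\<^sup>2 - (v x)\<^sup>2\<bar>) = (\<Sum>x\<in>A. \<bar>u x - v x\<bar> * \<bar>u x + v x\<bar>)"
    by (intro sum.cong) (auto simp: abs_mult[symmetric] power2_eq_square algebra_simps)
  also have "\<dots>\<^sup>2 \<le> (\<Sum>x\<in>A. \<bar>u x - v x\<bar>\<^sup>2) * (\<Sum>x\<in>A. \<bar>u x + v x\<bar>\<^sup>2)"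
    by (rule Cauchy_Schwarz_ineq_sum)
  also have "(\<Sum>x\<in>A. \<bar>u x - v x\<bar>\<^sup>2) = (\<Sum>x\<in>A. u x * u x + v x * v x - 2 * (u x * v x))"
    by (intro sum.cong) (auto simp: power2_eq_square algebra_simps)
  also have "\<dots> = 2 - 2 * c"
    using assms by (simp add: sum.distrib sum_subtractf sum_distrib_left[symmetric])
  also have "(\<Sum>x\<in>A. \<bar>u x + v x\<bar>\<^sup>2) = (\<Sum>x\<in>A. u x * u x + v x * v x + 2 * (u x * v x))"
    by (intro sum.cong) (auto simp: power2_eq_square algebra_simps)
  also have "\<dots> = 2 + 2 * c"
    using assms by (simp add: sum.distrib sum_distrib_left[symmetric])
  also have "(2 - 2 * c) * (2 + 2 * c) \<le> (2 - 2 * c) * 4" using c by (intro mult_left_mono) auto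
  finally show ?thesis by simp
qed

lemma is_cut_image:
  assumes g: "bij g" "\<And>n. \<bar>g n - n\<bar> \<le> C" and A: "is_cut A"
  shows "is_cut (g ` A)"
proof -
  obtain M where M: "\<And>n. n > M \<Longrightarrow> n \<in> A" "\<And>n. n < - M \<Longrightarrow> n \<notin> A" using A is_cut_def by auto
  have "(n > M + C \<longrightarrow> n \<in> g ` A) \<and> (n < - (M + C) \<longrightarrow> n \<notin> g ` A)" for n
  proof -
    obtain m where m: "n = g m" using g(1) by (metis bij_pointE)
    then have "n \<in> g ` A \<longleftrightarrow> m \<in> A" using g(1) by (simp add: inj_image_mem_iff bij_is_inj)
    then show ?thesis using M[of m] g(2)[of m] m by auto
  qed
  then show ?thesis unfolding is_cut_def by blast
qed

text \<open>
  The angles increase linearly over an interval of length \<open>N\<close>. A permutation of displacement at most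
  \<open>C\<close> changes about \<open>N\<close> of them, each by \<open>O(C / N)\<close>. Each factor of the inner product of the two
  amplitudes therefore differs from one by \<open>O((C / N)\<^sup>2)\<close>, and the inner product by \<open>O(C\<^sup>2 / N)\<close>.
\<close>

lemma almost_invariant_cut_measure:
  assumes F: "finite F" and bij: "\<And>g. g \<in> F \<Longrightarrow> bij g"
    and disp: "\<And>g. g \<in> F \<Longrightarrow> \<exists>C. \<forall>n. \<bar>g n - n\<bar> \<le> C" and \<epsilon>: "(\<epsilon>::real) > 0"
  shows "\<exists>p Y. finite Y \<and> Y \<subseteq> {A. is_cut A} \<and> (\<forall>A. 0 \<le> p A) \<and> (\<forall>A. A \<notin> Y \<longrightarrow> p A = 0) \<and> sum p Y = 1 \<and>
    (\<forall>g \<in> F. \<forall>Z \<subseteq> {A. is_cut A}. finite Z \<longrightarrow> (\<Sum>A\<in>Z. \<bar>p (g ` A) - p A\<bar>) \<le> \<epsilon>)"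
proof -
  obtain d where d: "\<And>g n. g \<in> F \<Longrightarrow> \<bar>g n - n\<bar> \<le> d g" using disp by metis
  define C where "C = nat (Max (insert 0 (d ` F)))"
  have C: "\<bar>g n - n\<bar> \<le> int C" if "g \<in> F" for g n
  proof -
    have "d g \<le> Max (insert 0 (d ` F))" using F that by (intro Max_ge) auto
    then show ?thesis using d[OF that, of n] unfolding C_def by linarith
  qed
  \<comment> \<open>The estimate below bounds the squared error by \<open>48 * C\<^sup>2 / N\<close>.\<close>
  obtain N where N: "N > 0" "C \<le> N" "48 * real C ^ 2 \<le> real N * \<epsilon>\<^sup>2"
  proof -
    obtain n where n: "48 * real C ^ 2 / \<epsilon>\<^sup>2 < real n" using reals_Archimedean2 by blast
    have "48 * real C ^ 2 \<le> real (n + C + 1) * \<epsilon>\<^sup>2"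
    proof -
      have "48 * real C ^ 2 \<le> real n * \<epsilon>\<^sup>2" using n \<epsilon> by (simp add: field_simps)
      also have "\<dots> \<le> real (n + C + 1) * \<epsilon>\<^sup>2" by (intro mult_right_mono) auto
      finally show ?thesis .
    qed
    then show thesis using that[of "n + C + 1"] by simp
  qed
  define a b where "a = - int C" and "b = int N + int C"
  define Y where "Y = step_sets a b"
  define p where "p A = (if is_cut A then (amplitude (ramp N) A)\<^sup>2 else 0)" for A
  have ab: "a \<le> b" by (simp add: a_def b_def)
  have s: "slope a b (ramp N)"
    using slope_ramp[OF N(1)] unfolding slope_def a_def b_def by auto
  have sg: "slope a b (ramp N \<circ> g)" if "g \<in> F" for g
    unfolding slope_def
  proof (intro conjI allI impI)
    fix j assume "j < a"
    then have "g j < 0" using C[OF that, of j] unfolding a_def by linarith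
    then show "(ramp N \<circ> g) j = 0" using slope_ramp[OF N(1)] by (simp add: slope_def)
  next
    fix j assume "j \<ge> b"
    then have "g j \<ge> int N" using C[OF that, of j] unfolding b_def by linarith
    then show "(ramp N \<circ> g) j = pi / 2" using slope_ramp[OF N(1)] by (simp add: slope_def)
  qed
  have Y: "finite Y" "Y \<subseteq> {A. is_cut A}" unfolding Y_def using finite_step_sets is_cut_step_sets by auto
  have p0: "p A = 0" if "A \<notin> Y" for A
    using amplitude_outside[OF s, of A] that by (simp add: p_def Y_def)
  have norm: "(\<Sum>A\<in>Y. amplitude \<theta> A * amplitude \<theta> A) = 1" if "slope a b \<theta>" for \<theta>
    using amplitude_inner_product[OF that that ab] by (simp add: Y_def)
  have "sum p Y = 1"
    using norm[OF s] Y by (simp add: p_def power2_eq_square subset_iff cong: sum.cong)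
  moreover have "(\<Sum>A\<in>Z. \<bar>p (g ` A) - p A\<bar>) \<le> \<epsilon>" if g: "g \<in> F" and Z: "Z \<subseteq> {A. is_cut A}" "finite Z" for g Z
  proof -
    let ?\<theta> = "ramp N" and ?\<phi> = "ramp N \<circ> g"
    define c where "c = (\<Prod>j\<in>{a..<b}. cos (?\<theta> j - ?\<phi> j))"
    have is_cut_image: "is_cut (g ` A)" if "is_cut A" for A
      by (rule is_cut_image[OF bij[OF g] C[OF g] that])
    have pg: "p (g ` A) = (amplitude ?\<phi> A)\<^sup>2" if "is_cut A" for A
      using that is_cut_image by (simp add: p_def amplitude_image[OF bij[OF g]])
    have zero: "\<bar>p (g ` A) - p A\<bar> = 0" if "A \<in> Z" "A \<notin> Y" for A
      using that Z pg[of A] p0 amplitude_outside[OF sg[OF g], of A] by (auto simp: Y_def)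
    have "(\<Sum>A\<in>Z. \<bar>p (g ` A) - p A\<bar>) = (\<Sum>A\<in>Z \<inter> Y. \<bar>p (g ` A) - p A\<bar>)"
      by (rule sum.mono_neutral_right[OF Z(2)]) (use zero in auto)
    also have "\<dots> \<le> (\<Sum>A\<in>Y. \<bar>p (g ` A) - p A\<bar>)" by (rule sum_mono2) (use Y in auto)
    also have "\<dots> = (\<Sum>A\<in>Y. \<bar>(amplitude ?\<theta> A)\<^sup>2 - (amplitude ?\<phi> A)\<^sup>2\<bar>)"
      using Y(2) pg by (intro sum.cong) (auto simp: p_def)
    finally have le: "(\<Sum>A\<in>Z. \<bar>p (g ` A) - p A\<bar>) \<le> \<dots>" .
    have cos01: "0 \<le> cos (?\<theta> j - ?\<phi> j) \<and> cos (?\<theta> j - ?\<phi> j) \<le> 1" for j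
      using ramp_bounds[of N j] ramp_bounds[of N "g j"] by (auto intro!: cos_ge_zero)
    note c = prod_ge_one_minus_sum[of "{a..<b}" "\<lambda>j. cos (?\<theta> j - ?\<phi> j)", OF _ cos01, folded c_def]
    have "1 - c \<le> (\<Sum>j\<in>{a..<b}. 1 - cos (?\<theta> j - ?\<phi> j))" using c(1) by simp
    also have "\<dots> \<le> (\<Sum>j\<in>{a..<b}. 2 * (real C / N)\<^sup>2)"
    proof (rule sum_mono)
      fix j
      have "\<bar>?\<theta> j - ?\<phi> j\<bar> \<le> 2 * (\<bar>real_of_int (j - g j)\<bar> / N)" using ramp_lipschitz[OF N(1)] by simp
      also have "\<dots> \<le> 2 * (real C / N)"
      proof -
        have "\<bar>j - g j\<bar> \<le> int C" using C[OF g, of j] by linarith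
        then have "\<bar>real_of_int (j - g j)\<bar> \<le> real C" by linarith
        then show ?thesis by (simp add: divide_right_mono)
      qed
      finally have "(?\<theta> j - ?\<phi> j)\<^sup>2 \<le> (2 * (real C / N))\<^sup>2"
        by (metis abs_ge_zero power2_abs power_mono)
      then show "1 - cos (?\<theta> j - ?\<phi> j) \<le> 2 * (real C / N)\<^sup>2"
        using one_minus_cos_le[of "?\<theta> j - ?\<phi> j"] unfolding power_mult_distrib by simp
    qed
    also have "\<dots> = (real N + 2 * real C) * (2 * (real C / N)\<^sup>2)" by (simp add: a_def b_def)
    also have "\<dots> \<le> (3 * real N) * (2 * (real C / N)\<^sup>2)" using N(2) by (intro mult_right_mono) auto
    also have "\<dots> = 6 * (real C)\<^sup>2 / N" using N(1) by (simp add: power2_eq_square field_simps)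
    finally have "8 * (1 - c) \<le> 48 * (real C)\<^sup>2 / N" by simp
    also have "\<dots> \<le> \<epsilon>\<^sup>2" using N by (simp add: field_simps)
    finally have "8 * (1 - c) \<le> \<epsilon>\<^sup>2" .
    moreover have "(\<Sum>A\<in>Y. \<bar>(amplitude ?\<theta> A)\<^sup>2 - (amplitude ?\<phi> A)\<^sup>2\<bar>)\<^sup>2 \<le> 8 * (1 - c)"
    proof (rule sum_diff_squares_le[OF Y(1) norm[OF s] norm[OF sg[OF g]]])
      show "(\<Sum>A\<in>Y. amplitude ?\<theta> A * amplitude ?\<phi> A) = c"
        unfolding Y_def c_def by (rule amplitude_inner_product[OF s sg[OF g] ab])
    qed (use c in auto)
    ultimately have "(\<Sum>A\<in>Y. \<bar>(amplitude ?\<theta> A)\<^sup>2 - (amplitude ?\<phi> A)\<^sup>2\<bar>) \<le> \<epsilon>"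
      using \<epsilon> by (meson order_trans power2_le_imp_le less_imp_le)
    with le show ?thesis by linarith
  qed
  ultimately show ?thesis using Y p0 by (intro exI[of _ p] exI[of _ Y]) (auto simp: p_def)
qed

section \<open>Amenable finitely generated simple groups\<close>

definition Gamma_group :: "nat set \<Rightarrow> (int \<Rightarrow> int) monoid" where
  "Gamma_group X = \<lparr>carrier = Gamma X, mult = (\<circ>), one = id\<rparr>"

lemma Gamma_group_simps [simp]:
  "carrier (Gamma_group X) = Gamma X" "f \<otimes>\<^bsub>Gamma_group X\<^esub> g = f \<circ> g" "\<one>\<^bsub>Gamma_group X\<^esub> = id"
  by (simp_all add: Gamma_group_def)

lemma group_Gamma_group: "group (Gamma_group X)"
proof (rule groupI)
  fix f assume "f \<in> carrier (Gamma_group X)"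
  then have "inv_into UNIV f \<in> carrier (Gamma_group X) \<and> inv_into UNIV f \<circ> f = id"
    using Gamma_inv inv_o_cancel[OF bij_is_inj[OF Gamma_bij]] by simp
  then show "\<exists>g\<in>carrier (Gamma_group X). g \<otimes>\<^bsub>Gamma_group X\<^esub> f = \<one>\<^bsub>Gamma_group X\<^esub>" by auto
qed (auto simp: Gamma_comp Gamma_id comp_assoc)

lemma inv_Gamma_group: "f \<in> Gamma X \<Longrightarrow> m_inv (Gamma_group X) f = inv_into UNIV f"
  by (rule group.inv_equality[OF group_Gamma_group]) (simp_all add: Gamma_inv inv_o_cancel[OF bij_is_inj[OF Gamma_bij]])

text \<open>
  The points that lie on the same side as \<open>n\<close> of all translates of the cut by multiples of \<open>P\<close>.
\<close>

definition block :: "int \<Rightarrow> int set \<Rightarrow> int \<Rightarrow> int set" where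
  "block P A n = {m. \<forall>t. m \<in> shift (P * t) A \<longleftrightarrow> n \<in> shift (P * t) A}"

lemma block_bounded:
  assumes "is_cut A" "P > 0"
  shows "\<exists>D. \<forall>n. \<forall>m \<in> block P A n. \<bar>m - n\<bar> \<le> D"
proof -
  obtain M where M: "\<And>n. n > M \<Longrightarrow> n \<in> A" "\<And>n. n < - M \<Longrightarrow> n \<notin> A" using assms(1) is_cut_def by auto
  have "\<bar>m - n\<bar> \<le> 2 * M + P + 1" if m: "m \<in> block P A n" for m n
  proof -
    have side: "m - P * t \<in> A \<longleftrightarrow> n - P * t \<in> A" for t using m by (simp add: block_def)
    \<comment> \<open>The translate by \<open>P * q\<close> contains \<open>n\<close>, and its edge is close below \<open>n\<close>.\<close>
    define q where "q = (n - M - 1) div P"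
    define r where "r = (n - M - 1) mod P"
    have n: "n - M - 1 = P * q + r" "0 \<le> r" "r < P" using assms(2) by (auto simp: q_def r_def)
    then have "n - P * q \<in> A" by (intro M(1)) linarith
    then have "m - P * q \<in> A" using side by blast
    then have "\<not> m - P * q < - M" using M(2) by blast
    then have 1: "m \<ge> n - (2 * M + P + 1)" using n by linarith
    \<comment> \<open>The translate by \<open>P * (q' + 1)\<close> does not contain \<open>n\<close>, and its edge is close above \<open>n\<close>.\<close>
    define q' where "q' = (n + M + 1) div P"
    define r' where "r' = (n + M + 1) mod P"
    have n': "n + M + 1 = P * q' + r'" "0 \<le> r'" "r' < P" using assms(2) by (auto simp: q'_def r'_def)
    have e: "P * (q' + 1) = P * q' + P" by (simp add: distrib_left)
    have "n - P * (q' + 1) \<notin> A" by (rule M(2)) (use n' e in linarith)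
    then have "m - P * (q' + 1) \<notin> A" using side by blast
    then have "\<not> m - P * (q' + 1) > M" using M(1) by blast
    then have 2: "m \<le> n + (2 * M + P + 1)" using n' e by linarith
    from 1 2 show ?thesis by linarith
  qed
  then show ?thesis by blast
qed

lemma common_period:
  assumes "finite Q" "\<And>g n. (g, n) \<in> Q \<Longrightarrow> toeplitz g"
  shows "\<exists>k. \<forall>(g, n) \<in> Q. \<forall>t. g (n + 2 ^ k * t) = g n + 2 ^ k * t"
  using assms
proof (induction Q rule: finite_induct)
  case (insert x Q)
  obtain h m where x: "x = (h, m)" by (cases x)
  have "toeplitz h" using insert.prems[of h m] x by simp
  then obtain l where l: "\<And>t. h (m + 2 ^ l * t) = h m + 2 ^ l * t" unfolding toeplitz_def by blast
  obtain k where k: "\<And>g n t. (g, n) \<in> Q \<Longrightarrow> g (n + 2 ^ k * t) = g n + 2 ^ k * t"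
    using insert by blast
  have "g (n + 2 ^ max k l * t) = g n + 2 ^ max k l * t" if gn: "(g, n) \<in> insert x Q" for g n t
  proof (cases "(g, n) = x")
    case True
    then show ?thesis using toeplitz_power_mono[of h m l "max k l", OF l] x by simp
  next
    case False
    then have "(g, n) \<in> Q" using gn by blast
    then show ?thesis using toeplitz_power_mono[of g n k "max k l", OF k] by simp
  qed
  then show ?case by blast
qed simp

text \<open>
  Whether a permutation of displacement at most \<open>C\<close> preserves a cut is decided in a finite window
  around the cut. A common period of the permutations on this window repeats the window, and hence the
  preserved cut.
\<close>

lemma stabilizer_preserves_translates:
  assumes A: "is_cut A" and T: "finite T" "\<And>g. g \<in> T \<Longrightarrow> bij g" "\<And>g. g \<in> T \<Longrightarrow> toeplitz g"
    "\<And>g. g \<in> T \<Longrightarrow> bounded_disp g" "\<And>g. g \<in> T \<Longrightarrow> g ` A = A"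
  shows "\<exists>P > 0. \<forall>g \<in> T. \<forall>t m. g m \<in> shift (P * t) A \<longleftrightarrow> m \<in> shift (P * t) A"
proof -
  obtain M where M: "\<And>n. n > M \<Longrightarrow> n \<in> A" "\<And>n. n < - M \<Longrightarrow> n \<notin> A" using A is_cut_def by auto
  obtain c where c: "\<And>g n. g \<in> T \<Longrightarrow> \<bar>g n - n\<bar> \<le> c g" using T(4) unfolding bounded_disp_def by metis
  define C where "C = Max (insert 0 (c ` T))"
  have C: "\<bar>g n - n\<bar> \<le> C" if "g \<in> T" for g n
  proof -
    have "c g \<le> C" unfolding C_def using T(1) that by (intro Max_ge) auto
    then show ?thesis using c[OF that, of n] by linarith
  qed
  have "\<exists>k. \<forall>(g, n) \<in> T \<times> {- (M + C)..M + C}. \<forall>t. g (n + 2 ^ k * t) = g n + 2 ^ k * t"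
    by (rule common_period) (use T in auto)
  then obtain k where k: "\<And>g n t. g \<in> T \<Longrightarrow> n \<in> {- (M + C)..M + C} \<Longrightarrow> g (n + 2 ^ k * t) = g n + 2 ^ k * t"
    by blast
  have "g m \<in> shift (2 ^ k * t) A \<longleftrightarrow> m \<in> shift (2 ^ k * t) A" if g: "g \<in> T" for g t m
  proof -
    define n where "n = m - 2 ^ k * t"
    have m: "m = n + 2 ^ k * t" by (simp add: n_def)
    consider "n \<in> {- (M + C)..M + C}" | "n > M + C" | "n < - (M + C)" by fastforce
    then have "g m - 2 ^ k * t \<in> A \<longleftrightarrow> n \<in> A"
    proof cases
      case 1
      then have "g m - 2 ^ k * t = g n" using k[OF g] m by simp
      moreover have "g n \<in> A \<longleftrightarrow> n \<in> A"
        using T(5)[OF g] inj_image_mem_iff[OF bij_is_inj[OF T(2)[OF g]], of n A] by simp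
      ultimately show ?thesis by simp
    next
      case 2
      then have "g m - 2 ^ k * t > M" "n > M" using C[OF g, of m] C[OF g, of n] unfolding m by linarith+
      then show ?thesis using M(1) by blast
    next
      case 3
      then have "g m - 2 ^ k * t < - M" "n < - M" using C[OF g, of m] C[OF g, of n] unfolding m by linarith+
      then show ?thesis using M(2) by blast
    qed
    then show ?thesis by (simp add: n_def)
  qed
  then show ?thesis by (intro exI[of _ "2 ^ k"]) simp
qed

text \<open>
  The generated subgroup preserves blocks of bounded size. On each block it is determined by the
  action of the generators there, and up to translation only finitely many actions on a block are
  possible. So an element is determined by its values at one representative of each type of block.
\<close>

lemma stabilizer_locally_finite:
  assumes A: "is_cut A" and T: "finite T" "T \<subseteq> Gamma X" "\<And>g. g \<in> T \<Longrightarrow> g ` A = A"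
  shows "\<exists>H. finite H \<and> subgroup H (Gamma_group X) \<and> T \<subseteq> H"
proof -
  interpret group "Gamma_group X" by (rule group_Gamma_group)
  have "\<exists>P > 0. \<forall>g \<in> T. \<forall>t m. g m \<in> shift (P * t) A \<longleftrightarrow> m \<in> shift (P * t) A"
    by (rule stabilizer_preserves_translates[OF A])
      (use T Gamma_bij Gamma_toeplitz Gamma_bounded_disp in blast)+
  then obtain P where P: "P > 0" "\<And>g t m. g \<in> T \<Longrightarrow> g m \<in> shift (P * t) A \<longleftrightarrow> m \<in> shift (P * t) A"
    by blast
  obtain D where D: "\<And>n m. m \<in> block P A n \<Longrightarrow> \<bar>m - n\<bar> \<le> D" using block_bounded[OF A P(1)] by blast
  have T_block: "g m \<in> block P A n \<longleftrightarrow> m \<in> block P A n" if "g \<in> T" for g m n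
    using P(2)[OF that] by (simp add: block_def)
  let ?H = "generate (Gamma_group X) T"
  have HG: "?H \<subseteq> Gamma X" using generate_incl[of T] T(2) by simp
  have inv_cancel: "inv_into UNIV g (g m) = m" "g (inv_into UNIV g m) = m" if "g \<in> T" for g m
    using Gamma_bij T(2) that by (auto simp: bij_is_inj bij_is_surj surj_f_inv_f)
  have H_block: "h m \<in> block P A n \<longleftrightarrow> m \<in> block P A n" if "h \<in> ?H" for h m n
    using that
  proof (induction arbitrary: m rule: generate.induct)
    case (inv g)
    then have e: "m_inv (Gamma_group X) g = inv_into UNIV g" using inv_Gamma_group T(2) by blast
    show ?case unfolding e using T_block[OF inv, of "inv_into UNIV g m" n] inv_cancel(2)[OF inv] by simp
  qed (auto simp: T_block)
  define similar where "similar n n' \<longleftrightarrow> (\<forall>g \<in> T. \<forall>m \<in> block P A n. g (m - n + n') = g m - n + n')" for n n'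
  have local: "h (m - n + n') = h m - n + n'" if "h \<in> ?H" "similar n n'" "m \<in> block P A n" for h m n n'
    using that
  proof (induction arbitrary: m rule: generate.induct)
    case (incl g)
    then show ?case by (auto simp: similar_def)
  next
    case (inv g)
    then have g: "g \<in> T" and e: "m_inv (Gamma_group X) g = inv_into UNIV g" using inv_Gamma_group T(2) by blast+
    define l where "l = inv_into UNIV g m"
    have l: "g l = m" using \<open>g \<in> T\<close> by (simp add: l_def inv_cancel)
    then have "l \<in> block P A n" using T_block[OF g, of l n] inv.prems by simp
    then have "g (l - n + n') = g l - n + n'" using inv.prems(1) g unfolding similar_def by blast
    then have "g (l - n + n') = m - n + n'" unfolding l .
    then have "inv_into UNIV g (m - n + n') = l - n + n'" using inv_cancel(1)[OF g, of "l - n + n'"] by simp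
    then show ?case by (simp add: e l_def)
  next
    case (eng h1 h2)
    then have "h2 m \<in> block P A n" using H_block by blast
    with eng show ?case by simp
  qed simp
  \<comment> \<open>The action of the generators on the block of \<open>n\<close>, in coordinates relative to \<open>n\<close>.\<close>
  define type_of where "type_of n = {(g, s, d). g \<in> T \<and> n + s \<in> block P A n \<and> d = g (n + s) - n}" for n
  have "range type_of \<subseteq> Pow (T \<times> {-D..D} \<times> {-D..D})"
  proof -
    have "s \<in> {-D..D} \<and> g (n + s) - n \<in> {-D..D}" if "g \<in> T" "n + s \<in> block P A n" for g n s
      using D[OF that(2)] D[OF T_block[OF that(1), THEN iffD2, OF that(2)]] by auto
    then show ?thesis unfolding type_of_def by auto
  qed
  then have fin_types: "finite (range type_of)" using T(1) finite_subset by blast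
  have similar: "similar n n'" if "type_of n = type_of n'" for n n'
    unfolding similar_def
  proof (intro ballI)
    fix g m assume "g \<in> T" "m \<in> block P A n"
    then have "(g, m - n, g m - n) \<in> type_of n" by (simp add: type_of_def)
    then have "(g, m - n, g m - n) \<in> type_of n'" using that by simp
    then have "g m - n = g (n' + (m - n)) - n'" by (simp add: type_of_def)
    then show "g (m - n + n') = g m - n + n'" by (simp add: algebra_simps)
  qed
  define R where "R = (\<lambda>\<tau>. SOME n. type_of n = \<tau>) ` range type_of"
  have R: "\<exists>r \<in> R. type_of r = type_of n" for n
  proof -
    have "type_of (SOME m. type_of m = type_of n) = type_of n" by (rule someI) simp
    then show ?thesis unfolding R_def by blast
  qed
  have "finite R" unfolding R_def using fin_types by simp
  have self: "n \<in> block P A n" for n by (simp add: block_def)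
  have "inj_on (\<lambda>h. restrict h R) ?H"
  proof (rule inj_onI)
    fix h h' assume h: "h \<in> ?H" "h' \<in> ?H" "restrict h R = restrict h' R"
    show "h = h'"
    proof
      fix n
      obtain r where r: "r \<in> R" "type_of r = type_of n" using R by blast
      have "h r = h' r" using h(3) r(1) by (metis restrict_apply')
      then show "h n = h' n"
        using local[OF h(1) similar[OF r(2)] self] local[OF h(2) similar[OF r(2)] self] by simp
    qed
  qed
  moreover have "(\<lambda>h. restrict h R) ` ?H \<subseteq> PiE R (\<lambda>r. {r - D..r + D})"
  proof -
    have "h r \<in> {r - D..r + D}" if "h \<in> ?H" for h r
    proof -
      have "h r \<in> block P A r" using H_block[OF that] self by blast
      then show ?thesis using D[of "h r" r] by auto
    qed
    then show ?thesis by auto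
  qed
  moreover have "finite (PiE R (\<lambda>r. {r - D..r + D}))" using \<open>finite R\<close> by (intro finite_PiE) auto
  ultimately have "finite ?H" using finite_subset finite_imageD by blast
  moreover have "subgroup ?H (Gamma_group X)" using generate_is_subgroup[of T] T(2) by simp
  moreover have "T \<subseteq> ?H" by (auto intro: generate.incl)
  ultimately show ?thesis by blast
qed

theorem amenable_Gamma_group: "amenable_group (Gamma_group X)"
proof -
  interpret group_acting "Gamma_group X" "\<lambda>g A. g ` A" "{A. is_cut A}"
  proof (intro group_acting.intro group_acting_axioms.intro group_Gamma_group)
    fix g A assume g: "g \<in> carrier (Gamma_group X)" and "A \<in> {A. is_cut A}"
    moreover from g have "bounded_disp g" using Gamma_bounded_disp by simp
    then obtain C where "\<forall>n. \<bar>g n - n\<bar> \<le> C" unfolding bounded_disp_def by blast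
    moreover have "bij g" using Gamma_bij g by simp
    ultimately show "g ` A \<in> {A. is_cut A}" using is_cut_image[of g C A] by simp
  qed (auto simp: image_comp)
  show ?thesis
  proof (rule amenable_if_almost_invariant)
    fix A T assume "A \<in> {A. is_cut A}" "finite T" "T \<subseteq> carrier (Gamma_group X)" "\<And>g. g \<in> T \<Longrightarrow> g ` A = A"
    then show "\<exists>H. finite H \<and> subgroup H (Gamma_group X) \<and> T \<subseteq> H"
      using stabilizer_locally_finite[of A T X] by simp
  next
    fix F and \<epsilon> :: real
    assume F: "finite F" "F \<subseteq> carrier (Gamma_group X)" "\<epsilon> > 0"
    have "bij g" "\<exists>C. \<forall>n. \<bar>g n - n\<bar> \<le> C" if "g \<in> F" for g
      using that F(2) Gamma_bij Gamma_bounded_disp[of g X] unfolding bounded_disp_def by auto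
    from almost_invariant_cut_measure[OF F(1) this F(3)]
    show "\<exists>p Y. finite Y \<and> Y \<subseteq> {A. is_cut A} \<and> (\<forall>x. 0 \<le> p x) \<and> (\<forall>x. x \<notin> Y \<longrightarrow> p x = 0) \<and> sum p Y = 1 \<and>
        (\<forall>g \<in> F. \<forall>Z \<subseteq> {A. is_cut A}. finite Z \<longrightarrow> (\<Sum>x\<in>Z. \<bar>p (g ` x) - p x\<bar>) \<le> \<epsilon>)" .
  qed
qed

theorem simple_Gamma_group: "is_simple_group (Gamma_group X)"
  unfolding is_simple_group_def
proof (intro conjI allI impI)
  show "group (Gamma_group X)" by (rule group_Gamma_group)
  show "carrier (Gamma_group X) \<noteq> {\<one>\<^bsub>Gamma_group X\<^esub>}" using infinite_Gamma[of X] by auto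
  fix N assume N: "N \<lhd> Gamma_group X"
  then interpret N: normal N "Gamma_group X" .
  have sg: "subgroup N (Gamma_group X)" by (rule N.subgroup_axioms)
  have sub: "N \<subseteq> Gamma X" using subgroup.subset[OF sg] by simp
  have "normal_subset X N"
  proof
    show "N \<subseteq> Gamma X" by (rule sub)
    show "id \<in> N" using subgroup.one_closed[OF sg] by simp
    show "f \<circ> g \<in> N" if "f \<in> N" "g \<in> N" for f g using subgroup.m_closed[OF sg that] by simp
    show "inv_into UNIV f \<in> N" if "f \<in> N" for f using subgroup.m_inv_closed[OF sg that] inv_Gamma_group[OF subsetD[OF sub that]] by simp
    show "\<sigma> \<circ> (f \<circ> inv_into UNIV \<sigma>) \<in> N" if "\<sigma> \<in> Gamma X" "f \<in> N" for \<sigma> f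
      using N.inv_op_closed2[of \<sigma> f] that inv_Gamma_group by (simp add: comp_assoc)
  qed
  from normal_subset.N_trivial_or_full[OF this] show "N = carrier (Gamma_group X) \<or> N = {\<one>\<^bsub>Gamma_group X\<^esub>}" by auto
qed

theorem finitely_generated_Gamma_group: "finitely_generated_group (Gamma_group X)"
  unfolding finitely_generated_group_def
proof (intro conjI exI[of _ "generator X ` {..8}"])
  interpret group "Gamma_group X" by (rule group_Gamma_group)
  show "group (Gamma_group X)" by (rule group_Gamma_group)
  have gens: "generator X i \<in> Gamma X" for i using Gamma_word_maps[OF word_maps_generator[of i]] .
  then show sub: "generator X ` {..8} \<subseteq> carrier (Gamma_group X)" by auto
  have "eval_word X w \<in> generate (Gamma_group X) (generator X ` {..8})" for w
  proof (induction w)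
    case Nil
    then show ?case using generate.one[of "Gamma_group X" "generator X ` {..8}"] by (simp only: eval_word.simps Gamma_group_simps)
  next
    case (Cons i w)
    have "generator X i = generator X (min i 8)" by (auto simp: generator_def)
    then have "generator X i \<in> generator X ` {..8}" by (metis atMost_iff image_eqI min.cobounded2)
    then have "generator X i \<in> generate (Gamma_group X) (generator X ` {..8})" by (rule generate.incl)
    from generate.eng[OF this Cons] show ?case by (simp only: eval_word.simps Gamma_group_simps)
  qed
  then show "generate (Gamma_group X) (generator X ` {..8}) = carrier (Gamma_group X)"
    using generate_incl[OF sub] by (auto simp: Gamma_def)
qed simp

section \<open>Isomorphism classes\<close>

lemma group_on_naturals:
  fixes G :: "('a, 'b) monoid_scheme"
  assumes G: "group G" and count: "countable (carrier G)"
  shows "\<exists>H :: nat monoid. group H \<and> (\<exists>f. f \<in> iso G H)"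
proof -
  interpret group G by (rule G)
  let ?C = "carrier G"
  define f where "f = to_nat_on ?C"
  define b where "b = inv_into ?C f"
  have inj: "inj_on f ?C" unfolding f_def by (rule inj_on_to_nat_on[OF count])
  have b: "b (f x) = x" if "x \<in> ?C" for x using inj that by (simp add: b_def)
  define H :: "nat monoid" where
    "H = \<lparr>carrier = f ` ?C, mult = (\<lambda>m n. f (b m \<otimes>\<^bsub>G\<^esub> b n)), one = f \<one>\<^bsub>G\<^esub>\<rparr>"
  have iso: "f \<in> iso G H"
    by (rule isoI) (auto simp: H_def b hom_def bij_betw_def inj)
  from iso_imp_img_group[OF this] have "group H" by (simp add: H_def)
  with iso show ?thesis by blast
qed

context
  fixes G :: "('a, 'c) monoid_scheme" and H :: "('b, 'd) monoid_scheme" and \<phi>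
  assumes G: "group G" and H: "group H" and \<phi>: "\<phi> \<in> iso G H"
begin

interpretation G: group G by (rule G)
interpretation H: group H by (rule H)
interpretation \<phi>: group_hom G H \<phi>
  using \<phi> by (intro group_hom.intro group_hom_axioms.intro G H) (auto simp: iso_def)

lemma iso_bij: "inj_on \<phi> (carrier G)" "\<phi> ` carrier G = carrier H"
  using \<phi> by (auto simp: iso_def bij_betw_def)

lemma iso_finitely_generated:
  assumes "finitely_generated_group G" shows "finitely_generated_group H"
proof -
  obtain S where S: "finite S" "S \<subseteq> carrier G" "generate G S = carrier G"
    using assms unfolding finitely_generated_group_def by blast
  have "generate H (\<phi> ` S) = carrier H" using \<phi>.generate_img[OF S(2)] S(3) iso_bij(2) by simp
  moreover have "\<phi> ` S \<subseteq> carrier H" using S(2) iso_bij(2) by blast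
  ultimately show ?thesis unfolding finitely_generated_group_def using H S(1) by blast
qed

lemma iso_simple:
  assumes "is_simple_group G" shows "is_simple_group H"
  unfolding is_simple_group_def
proof (intro conjI allI impI)
  show "group H" by (rule H)
  show "carrier H \<noteq> {\<one>\<^bsub>H\<^esub>}"
  proof
    assume "carrier H = {\<one>\<^bsub>H\<^esub>}"
    then have const: "\<phi> x = \<phi> \<one>\<^bsub>G\<^esub>" if "x \<in> carrier G" for x using that \<phi>.hom_closed by auto
    have "x = \<one>\<^bsub>G\<^esub>" if "x \<in> carrier G" for x
      using inj_onD[OF iso_bij(1) const[OF that] that G.one_closed] .
    then have "carrier G = {\<one>\<^bsub>G\<^esub>}" using G.one_closed by auto
    then show False using assms by (simp add: is_simple_group_def)
  qed
  fix N assume N: "N \<lhd> H"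
  then interpret N: normal N H .
  define K where "K = {x \<in> carrier G. \<phi> x \<in> N}"
  have "K \<lhd> G"
  proof (rule G.normal_invI)
    show "subgroup K G"
      by unfold_locales (auto simp: K_def)
    fix x h assume "x \<in> carrier G" "h \<in> K"
    then show "x \<otimes>\<^bsub>G\<^esub> h \<otimes>\<^bsub>G\<^esub> inv\<^bsub>G\<^esub> x \<in> K"
      using N.inv_op_closed2[of "\<phi> x" "\<phi> h"] by (simp add: K_def)
  qed
  then have "K = carrier G \<or> K = {\<one>\<^bsub>G\<^esub>}" using assms by (simp add: is_simple_group_def)
  moreover have "N = \<phi> ` K"
  proof -
    have "N \<subseteq> \<phi> ` carrier G" using subgroup.subset[OF N.subgroup_axioms] iso_bij(2) by simp
    then show ?thesis unfolding K_def by auto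
  qed
  ultimately show "N = carrier H \<or> N = {\<one>\<^bsub>H\<^esub>}" using iso_bij(2) by auto
qed

lemma iso_amenable:
  assumes "amenable_group G" shows "amenable_group H"
proof -
  obtain \<mu> where \<mu>: "left_invariant_mean G \<mu>" using assms amenable_group_def by blast
  define pre where "pre A = {x \<in> carrier G. \<phi> x \<in> A}" for A
  have sub: "pre A \<subseteq> carrier G" for A by (auto simp: pre_def)
  have un: "pre (A \<union> B) = pre A \<union> pre B" "pre (A \<inter> B) = pre A \<inter> pre B" "pre {} = {}" for A B
    by (auto simp: pre_def)
  have full: "pre (carrier H) = carrier G" by (auto simp: pre_def)
  have coset: "pre (\<phi> g <#\<^bsub>H\<^esub> A) = g <#\<^bsub>G\<^esub> pre A" if g: "g \<in> carrier G" and A: "A \<subseteq> carrier H" for g A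
  proof
    show "g <#\<^bsub>G\<^esub> pre A \<subseteq> pre (\<phi> g <#\<^bsub>H\<^esub> A)" using g by (auto simp: pre_def l_coset_def)
    show "pre (\<phi> g <#\<^bsub>H\<^esub> A) \<subseteq> g <#\<^bsub>G\<^esub> pre A"
    proof
      fix x assume "x \<in> pre (\<phi> g <#\<^bsub>H\<^esub> A)"
      then obtain a where x: "x \<in> carrier G" "a \<in> A" "\<phi> x = \<phi> g \<otimes>\<^bsub>H\<^esub> a" by (auto simp: pre_def l_coset_def)
      obtain y where y: "y \<in> carrier G" "a = \<phi> y" using x(2) A iso_bij(2) by blast
      have "\<phi> x = \<phi> (g \<otimes>\<^bsub>G\<^esub> y)" using x(3) y g by simp
      then have "x = g \<otimes>\<^bsub>G\<^esub> y" by (rule inj_onD[OF iso_bij(1)]) (use x(1) y(1) g in simp_all)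
      then show "x \<in> g <#\<^bsub>G\<^esub> pre A" using y x(2) by (auto simp: pre_def l_coset_def)
    qed
  qed
  have "left_invariant_mean H (\<lambda>A. \<mu> (pre A))"
    unfolding left_invariant_mean_def
  proof (intro conjI allI impI ballI)
    fix A show "0 \<le> \<mu> (pre A)" using \<mu> sub by (simp add: left_invariant_mean_def)
  next
    show "\<mu> (pre (carrier H)) = 1" using \<mu> by (simp add: full left_invariant_mean_def)
  next
    fix A B :: "'b set" assume "A \<inter> B = {}"
    then have "pre A \<inter> pre B = {}" using un(2)[of A B] un(3) by simp
    then show "\<mu> (pre (A \<union> B)) = \<mu> (pre A) + \<mu> (pre B)"
      using \<mu> sub by (simp add: un(1) left_invariant_mean_def)
  next
    fix h A assume h: "h \<in> carrier H" and A: "A \<subseteq> carrier H"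
    then obtain g where g: "g \<in> carrier G" "h = \<phi> g" using iso_bij(2) by blast
    show "\<mu> (pre (h <#\<^bsub>H\<^esub> A)) = \<mu> (pre A)"
      using \<mu> sub g coset[OF g(1) A] by (simp add: left_invariant_mean_def)
  qed
  with H show ?thesis unfolding amenable_group_def by blast
qed

end

lemma countable_Gamma: "countable (Gamma X)"
  unfolding Gamma_def by simp

lemma Gamma_group_on_naturals:
  "\<exists>H :: nat monoid. fg_simple_infinite_amenable H \<and> Gamma_group X \<cong> H"
proof -
  have "\<exists>H :: nat monoid. group H \<and> (\<exists>f. f \<in> iso (Gamma_group X) H)"
    by (rule group_on_naturals) (simp_all add: group_Gamma_group countable_Gamma)
  then obtain H :: "nat monoid" and f where H: "group H" and f: "f \<in> iso (Gamma_group X) H" by blast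
  note iso = group_Gamma_group H f
  have "Gamma_group X \<cong> H" using f is_isoI by blast
  then have "infinite (carrier H)" using iso_finite infinite_Gamma by fastforce
  then have "fg_simple_infinite_amenable H" unfolding fg_simple_infinite_amenable_def
    using iso_finitely_generated[OF iso finitely_generated_Gamma_group] iso_simple[OF iso simple_Gamma_group]
      iso_amenable[OF iso amenable_Gamma_group] by blast
  with \<open>Gamma_group X \<cong> H\<close> show ?thesis by blast
qed

lemma generator_min: "generator X i = generator X (min i 8)"
  by (auto simp: generator_def)

text \<open>
  An isomorphism to a fixed group is recorded by nine words for the images of the generators. The
  record determines which words of the source are trivial, and hence the source.
\<close>

lemma countable_iso_class: "countable {X. Gamma_group X \<cong> Gamma_group Y}"
proof -
  let ?K = "{X. Gamma_group X \<cong> Gamma_group Y}"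
  have "\<exists>f. f \<in> iso (Gamma_group X) (Gamma_group Y)" if "X \<in> ?K" for X using that by (auto simp: is_iso_def)
  then obtain f where f: "\<And>X. X \<in> ?K \<Longrightarrow> f X \<in> iso (Gamma_group X) (Gamma_group Y)" by metis
  have gens: "generator X i \<in> Gamma X" for X i using Gamma_word_maps[OF word_maps_generator[of i]] .
  have f_closed: "f X g \<in> Gamma Y" if "X \<in> ?K" "g \<in> Gamma X" for X g
    using f[OF that(1)] that(2) by (auto simp: iso_def hom_def)
  have f_comp: "f X (g \<circ> h) = f X g \<circ> f X h" if "X \<in> ?K" "g \<in> Gamma X" "h \<in> Gamma X" for X g h
    using f[OF that(1)] that(2,3) by (simp add: iso_def hom_def)
  have f_inj: "inj_on (f X) (Gamma X)" if "X \<in> ?K" for X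
    using f[OF that] by (simp add: iso_def bij_betw_def)
  have f_id: "f X id = id" if "X \<in> ?K" for X
    using hom_one[of "f X" "Gamma_group X" "Gamma_group Y"] f[OF that] group_Gamma_group by (simp add: iso_def)
  have "\<exists>w. f X (generator X i) = eval_word Y w" if "X \<in> ?K" for X i
    using f_closed[OF that gens] by (auto simp: Gamma_def)
  then obtain u where u: "\<And>X i. X \<in> ?K \<Longrightarrow> f X (generator X i) = eval_word Y (u X i)" by metis
  define mark where "mark X = map (u X) [0..<9]" for X
  have mark: "f X (generator X i) = eval_word Y (mark X ! min i 8)" if "X \<in> ?K" for X i
  proof -
    have "mark X ! min i 8 = u X (min i 8)" by (simp add: mark_def del: upt_Suc)
    then show ?thesis using u[OF that, of "min i 8"] generator_min[of X i] by simp
  qed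
  have word: "f X (eval_word X w) = eval_word Y (concat (map (\<lambda>i. mark X ! min i 8) w))"
    if "X \<in> ?K" for X w
  proof (induction w)
    case Nil
    then show ?case using f_id[OF that] by (simp only: eval_word.simps list.map concat.simps)
  next
    case (Cons i w)
    have "eval_word X w \<in> Gamma X" by (simp add: Gamma_def)
    from f_comp[OF that gens this] show ?case
      by (simp only: eval_word.simps list.map concat.simps eval_word_append mark[OF that] Cons)
  qed
  have "inj_on mark ?K"
  proof (rule inj_onI)
    fix X X' assume X: "X \<in> ?K" "X' \<in> ?K" "mark X = mark X'"
    have id_iff: "eval_word X w = id \<longleftrightarrow> eval_word Y (concat (map (\<lambda>i. mark X ! min i 8) w)) = id" if "X \<in> ?K" for X w
    proof -
      have "eval_word X w \<in> Gamma X" by (simp add: Gamma_def)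
      then have "eval_word X w = id \<longleftrightarrow> f X (eval_word X w) = f X id"
        using f_inj[OF that] Gamma_id by (simp add: inj_on_eq_iff)
      then show ?thesis by (simp only: f_id[OF that] word[OF that])
    qed
    show "X = X'" by (rule relations_determine) (use id_iff[OF X(1)] id_iff[OF X(2)] X(3) in simp)
  qed
  then show ?thesis by (rule countableI')
qed

lemma Gamma_group_iso_sym: "Gamma_group X \<cong> Gamma_group Y \<Longrightarrow> Gamma_group Y \<cong> Gamma_group X"
  using group.iso_sym[OF group_Gamma_group] .

lemma Gamma_group_iso_trans: "Gamma_group X \<cong> Gamma_group Y \<Longrightarrow> Gamma_group Y \<cong> Gamma_group Z \<Longrightarrow> Gamma_group X \<cong> Gamma_group Z"
  using iso_trans by blast

lemma Gamma_group_iso_refl: "Gamma_group X \<cong> Gamma_group X"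
  by (rule iso_refl)

text \<open>
  A set of representatives \<open>R\<close> satisfies \<open>UNIV \<lesssim> R \<times> \<nat>\<close> since the classes are countable. As the left
  hand side is uncountable, \<open>R\<close> is infinite and absorbs the factor \<open>\<nat>\<close>.
\<close>

lemma continuum_many_classes:
  "\<exists>R. R \<approx> (UNIV :: nat set set) \<and> (\<forall>X \<in> R. \<forall>Y \<in> R. Gamma_group X \<cong> Gamma_group Y \<longrightarrow> X = Y)"
proof -
  define cls where "cls X = {Y. Gamma_group Y \<cong> Gamma_group X}" for X
  have cls_eq: "cls X = cls Y" if "Gamma_group X \<cong> Gamma_group Y" for X Y
    unfolding cls_def using that Gamma_group_iso_sym Gamma_group_iso_trans by blast
  define rep where "rep X = (SOME Y. Y \<in> cls X)" for X
  have rep: "Gamma_group (rep X) \<cong> Gamma_group X" for X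
  proof -
    have "rep X \<in> cls X" unfolding rep_def by (rule someI[of _ X]) (simp add: cls_def Gamma_group_iso_refl)
    then show ?thesis by (simp add: cls_def)
  qed
  have rep_eq: "rep X = rep Y" if "Gamma_group X \<cong> Gamma_group Y" for X Y
    unfolding rep_def cls_eq[OF that] ..
  let ?R = "range rep"
  have distinct: "X = Y" if XY: "X \<in> ?R" "Y \<in> ?R" "Gamma_group X \<cong> Gamma_group Y" for X Y
  proof -
    obtain X' Y' where e: "X = rep X'" "Y = rep Y'" using XY by blast
    have "Gamma_group X' \<cong> Gamma_group Y'" using XY(3) rep[of X'] rep[of Y'] unfolding e
      using Gamma_group_iso_sym Gamma_group_iso_trans by blast
    then show ?thesis unfolding e by (rule rep_eq)
  qed
  have "inj (\<lambda>X. (rep X, to_nat_on (cls (rep X)) X))"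
  proof (rule injI)
    fix X Y assume e: "(rep X, to_nat_on (cls (rep X)) X) = (rep Y, to_nat_on (cls (rep Y)) Y)"
    have ct: "countable (cls (rep X))" unfolding cls_def by (rule countable_iso_class)
    have mem: "X \<in> cls (rep X)" "Y \<in> cls (rep X)"
      using rep[of X] rep[of Y] e Gamma_group_iso_sym by (auto simp: cls_def)
    have "to_nat_on (cls (rep X)) X = to_nat_on (cls (rep X)) Y"
    proof -
      have "rep X = rep Y" "to_nat_on (cls (rep X)) X = to_nat_on (cls (rep Y)) Y"
        using e unfolding prod.inject by (rule conjunct1, rule conjunct2)
      then show ?thesis by simp
    qed
    from inj_onD[OF inj_on_to_nat_on[OF ct] this mem] show "X = Y" .
  qed
  then have le: "(UNIV :: nat set set) \<lesssim> ?R \<times> (UNIV :: nat set)"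
    unfolding lepoll_def by (intro exI[of _ "\<lambda>X. (rep X, to_nat_on (cls (rep X)) X)"]) auto
  have "infinite ?R"
  proof
    assume "finite ?R"
    then have "countable (?R \<times> (UNIV :: nat set))" 
      by (rule countable_SIGMA[OF countable_finite]) simp
    then have "countable (UNIV :: nat set set)" using le countable_lepoll by blast
    then have "(UNIV :: nat set set) \<lesssim> (UNIV :: nat set)"
      unfolding countable_def lepoll_def by auto
    moreover have "(UNIV :: nat set) \<prec> (UNIV :: nat set set)" using lesspoll_Pow_self[of "UNIV :: nat set"] by simp
    ultimately show False using lesspoll_trans1 lesspoll_not_refl by blast
  qed
  then have "?R \<times> (UNIV :: nat set) \<approx> ?R"
    unfolding eqpoll_iff_card_of_ordIso
    by (intro card_of_Times_infinite_simps(1)) (auto simp: infinite_iff_card_of_nat)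
  then have "(UNIV :: nat set set) \<lesssim> ?R" using le lepoll_trans2 by blast
  moreover have "?R \<lesssim> (UNIV :: nat set set)" by (rule subset_imp_lepoll) simp
  ultimately have "?R \<approx> (UNIV :: nat set set)" using lepoll_antisym by blast
  with distinct show ?thesis by blast
qed

theorem corollary2:
  shows "(\<exists>G. fg_simple_infinite_amenable G) \<and>
    (\<exists>\<G> :: nat monoid set.
       \<G> \<approx> (UNIV :: nat set set) \<and>
       (\<forall>G \<in> \<G>. fg_simple_infinite_amenable G) \<and>
       (\<forall>G \<in> \<G>. \<forall>H \<in> \<G>. G \<noteq> H \<longrightarrow> \<not> G \<cong> H))"
proof
  have "\<forall>X. \<exists>H :: nat monoid. fg_simple_infinite_amenable H \<and> Gamma_group X \<cong> H"
    by (intro allI Gamma_group_on_naturals)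
  from choice[OF this] obtain N :: "nat set \<Rightarrow> nat monoid"
    where "\<forall>X. fg_simple_infinite_amenable (N X) \<and> Gamma_group X \<cong> N X" by (elim exE)
  then have N: "\<And>X. fg_simple_infinite_amenable (N X)" "\<And>X. Gamma_group X \<cong> N X" by simp_all
  from N(1) show "\<exists>G. fg_simple_infinite_amenable G" by (rule exI)
  obtain R where R: "R \<approx> (UNIV :: nat set set)" "\<And>X Y. X \<in> R \<Longrightarrow> Y \<in> R \<Longrightarrow> Gamma_group X \<cong> Gamma_group Y \<Longrightarrow> X = Y"
    using continuum_many_classes by blast
  have eq: "X = Y" if "X \<in> R" "Y \<in> R" "N X \<cong> N Y" for X Y
  proof -
    have "N Y \<cong> Gamma_group Y" using group.iso_sym[OF group_Gamma_group N(2)] .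
    from iso_trans[OF iso_trans[OF N(2) that(3)] this] show ?thesis by (rule R(2)[OF that(1,2)])
  qed
  have "inj_on N R"
  proof (rule inj_onI)
    fix X Y assume "X \<in> R" "Y \<in> R" "N X = N Y"
    then show "X = Y" using eq iso_refl[of "N X"] by simp
  qed
  then have "N ` R \<approx> (UNIV :: nat set set)" using R(1) by simp
  moreover have "\<forall>G \<in> N ` R. fg_simple_infinite_amenable G" using N(1) by simp
  moreover have "\<forall>G \<in> N ` R. \<forall>H \<in> N ` R. G \<noteq> H \<longrightarrow> \<not> G \<cong> H"
  proof (intro ballI impI notI)
    fix G H assume "G \<in> N ` R" "H \<in> N ` R" and ne: "G \<noteq> H" and iso: "G \<cong> H"
    then obtain X Y where XY: "X \<in> R" "Y \<in> R" "G = N X" "H = N Y" by (elim imageE)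
    with iso have "X = Y" using eq by simp
    with XY ne show False by simp
  qed
  ultimately show "\<exists>\<G> :: nat monoid set. \<G> \<approx> (UNIV :: nat set set) \<and>
      (\<forall>G \<in> \<G>. fg_simple_infinite_amenable G) \<and> (\<forall>G \<in> \<G>. \<forall>H \<in> \<G>. G \<noteq> H \<longrightarrow> \<not> G \<cong> H)"
    by (intro exI[of _ "N ` R"] conjI)
qed

end
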